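(* Let $k>4$ be an integer. In $\mathbb{R}^3$ with coordinates $(x,y,t)$, define the semialgebraic surfaces $$X_1=\Big\{\big((x^2-2xt+y^2)(x^2+2xt+y^2)-t^k\big)\Big((x-t)^2+\big(y-\tfrac{t}{2}\big)^2-\tfrac{t^2}{16}\Big)\Big((x-t)^2+\big(y+\tfrac{t}{2}\big)^2-\tfrac{t^2}{16}\Big)=0,\ t\ge 0\Big\},$$ $$X_2=\Big\{\big((x^2-2xt+y^2)(x^2+2xt+y^2)-t^k\big)\Big((x-t)^2+y^2-\tfrac{t^2}{16}\Big)\Big((x+t)^2+y^2-\tfrac{t^2}{16}\Big)=0,\ t\ge 0\Big\}.$$ Then the germs at the origin of $X_1$ and $X_2$ are bi-Lipschitz equivalent with respect to the outer metric and ambient topologically equivalent, but they are not ambient Lipschitz equivalent.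
   Context: For germs at $0$ of semialgebraic sets $X,Y\subset\mathbb{R}^n$: the outer metric on $X$ is the restriction of the Euclidean distance of $\mathbb{R}^n$; $X$ and $Y$ are bi-Lipschitz equivalent with respect to the outer metric if there is a germ of homeomorphism $X\to Y$ that is bi-Lipschitz for the outer metrics. They are ambient topologically equivalent if there is a germ of homeomorphism $(\mathbb{R}^n,0)\to(\mathbb{R}^n,0)$ mapping the germ of $X$ onto the germ of $Y$, and ambient Lipschitz (bi-Lipschitz) equivalent if there is such a germ of homeomorphism that is bi-Lipschitz. *)

theory Defs
  imports "HOL-Analysis.Analysis"
begin

text \<open>Points of R^3 are triples (x, y, t) :: real \<times> real \<times> real; the norm on this
product type is the Euclidean norm sqrt (x^2 + y^2 + t^2).\<close>

definition outer_lipschitz_equiv :: "'a::real_normed_vector set \<Rightarrow> 'a set \<Rightarrow> bool" where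
  "outer_lipschitz_equiv X Y \<longleftrightarrow>
     (\<exists>U V h g L. open U \<and> open V \<and> 0 \<in> U \<and> 0 \<in> V \<and>
        homeomorphism (X \<inter> U) (Y \<inter> V) h g \<and> h 0 = 0 \<and> L > 0 \<and>
        (\<forall>a\<in>X \<inter> U. \<forall>b\<in>X \<inter> U.
            dist a b \<le> L * dist (h a) (h b) \<and> dist (h a) (h b) \<le> L * dist a b))"

definition ambient_topo_equiv :: "'a::real_normed_vector set \<Rightarrow> 'a set \<Rightarrow> bool" where
  "ambient_topo_equiv X Y \<longleftrightarrow>
     (\<exists>U V h g. open U \<and> open V \<and> 0 \<in> U \<and> 0 \<in> V \<and>
        homeomorphism U V h g \<and> h 0 = 0 \<and> h ` (X \<inter> U) = Y \<inter> V)"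

definition ambient_lipschitz_equiv :: "'a::real_normed_vector set \<Rightarrow> 'a set \<Rightarrow> bool" where
  "ambient_lipschitz_equiv X Y \<longleftrightarrow>
     (\<exists>U V h g L. open U \<and> open V \<and> 0 \<in> U \<and> 0 \<in> V \<and>
        homeomorphism U V h g \<and> h 0 = 0 \<and> h ` (X \<inter> U) = Y \<inter> V \<and> L > 0 \<and>
        (\<forall>a\<in>U. \<forall>b\<in>U.
            dist a b \<le> L * dist (h a) (h b) \<and> dist (h a) (h b) \<le> L * dist a b))"

definition X1 :: "nat \<Rightarrow> (real \<times> real \<times> real) set" where
  "X1 k = {(x, y, t). t \<ge> 0 \<and>
      ((x^2 - 2*x*t + y^2) * (x^2 + 2*x*t + y^2) - t^k) *
      ((x - t)^2 + (y - t/2)^2 - t^2/16) *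
      ((x - t)^2 + (y + t/2)^2 - t^2/16) = 0}"

definition X2 :: "nat \<Rightarrow> (real \<times> real \<times> real) set" where
  "X2 k = {(x, y, t). t \<ge> 0 \<and>
      ((x^2 - 2*x*t + y^2) * (x^2 + 2*x*t + y^2) - t^k) *
      ((x - t)^2 + y^2 - t^2/16) *
      ((x + t)^2 + y^2 - t^2/16) = 0}"

end

theory Submission
  imports Defs
begin

text \<open>
At height \<open>t\<close>, in the coordinates \<open>u = x / t\<close>, \<open>v = y / t\<close>, the quartic factor is a closed curve
(the "peanut") around two tangent unit discs, joined at the origin by a neck of width of order
\<open>t powr ((k - 4) / 4)\<close>. The other two factors are cones over round circles: both
in the same lobe for \<open>X1\<close>, one in each lobe for \<open>X2\<close>.

Outer equivalence: the three pieces are at distance comparable to \<open>t\<close> from each other, so the map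
that is the identity on the peanut and a linear shear on each cone is bi-Lipschitz.

Topological equivalence: at each height one circle can be flattened and slid through the neck by
fibrewise monotone piecewise linear maps supported inside the peanut. These maps depend
continuously on the height, and invariance of domain makes their composition a homeomorphism.

No ambient bi-Lipschitz equivalence \<open>h\<close>: the two neck points of the peanut are at distance
\<open>o(t)\<close>, but every connected subset of the surface that contains both has diameter of order \<open>t\<close>.
Round cones have no such pairs of points, so \<open>h\<close> preserves the peanut and permutes the cones.
In \<open>X1\<close> the cones are joined, at each height, by a segment at distance of order \<open>t\<close> from the
peanut. Its image runs inside the peanut from one lobe to the other, hence passes through the neck
at distance \<open>o(t)\<close> from the peanut, a contradiction.
\<close>

section \<open>The pieces of the surfaces\<close>

definition height :: "real \<times> real \<times> real \<Rightarrow> real" where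
  "height p = snd (snd p)"

text \<open>Horizontal vector from the axis of the cone over \<open>c\<close> to \<open>p\<close>.
  It is linear in \<open>p\<close>, so a bound on its norm is at once a Lipschitz bound.\<close>

definition offset :: "real \<times> real \<Rightarrow> real \<times> real \<times> real \<Rightarrow> real \<times> real" where
  "offset c p = (fst p, fst (snd p)) - height p *\<^sub>R c"

definition shear :: "real \<times> real \<Rightarrow> real \<times> real \<times> real \<Rightarrow> real \<times> real \<times> real" where
  "shear v p = (fst p + height p * fst v, fst (snd p) + height p * snd v, height p)"

definition circ_cone :: "real \<times> real \<Rightarrow> (real \<times> real \<times> real) set" where
  "circ_cone c = {p. 0 \<le> height p \<and> norm (offset c p) = height p / 4}"

definition peanut_fun :: "nat \<Rightarrow> real \<times> real \<times> real \<Rightarrow> real" where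
  "peanut_fun k = (\<lambda>(x, y, t). (x^2 - 2*x*t + y^2) * (x^2 + 2*x*t + y^2) - t^k)"

definition peanut :: "nat \<Rightarrow> (real \<times> real \<times> real) set" where
  "peanut k = {p. 0 \<le> height p \<and> peanut_fun k p = 0}"

lemma height_simps [simp]:
  "height (x, y, t) = t" "height 0 = 0" "height (p - q) = height p - height q"
  "height (shear v p) = height p"
  by (simp_all add: height_def shear_def)

lemma offset_diff: "offset c (p - q) = offset c p - offset c q"
  by (simp add: offset_def algebra_simps prod_eq_iff)

lemma offset_shear [simp]: "offset (c + v) (shear v p) = offset c p"
  by (simp add: offset_def shear_def prod_eq_iff algebra_simps)

lemma abs_height_le: "\<bar>height p\<bar> \<le> norm p"
  unfolding height_def
  by (metis norm_snd_le order_trans prod.collapse real_norm_def)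

lemma height_le: "height p \<le> norm p"
  using abs_height_le[of p] by linarith

lemma norm_fst_snd_le: "norm (fst p, fst (snd p)) \<le> norm (p :: real \<times> real \<times> real)"
  by (cases p) (simp add: norm_Pair)

lemma norm_le_offset: "norm p \<le> norm (offset c p) + (norm c + 1) * \<bar>height p\<bar>"
proof -
  have "p = (fst p, fst (snd p), 0) + (0, 0, height p)"
    by (simp add: height_def prod_eq_iff)
  then have "norm p \<le> norm (fst p, fst (snd p), 0::real) + norm (0::real, 0::real, height p)"
    by (metis norm_triangle_ineq)
  also have "norm (fst p, fst (snd p), 0::real) = norm (fst p, fst (snd p))"
    by (simp add: norm_Pair)
  also have "norm (0::real, 0::real, height p) = \<bar>height p\<bar>"
    by (simp add: norm_Pair)
  also have "norm (fst p, fst (snd p)) \<le> norm (offset c p) + norm (height p *\<^sub>R c)"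
    unfolding offset_def by (metis diff_add_cancel norm_triangle_ineq)
  finally show ?thesis by (simp add: algebra_simps)
qed

lemma norm_offset_le: "norm (offset c p) \<le> (1 + norm c) * norm p"
proof -
  have "norm (offset c p) \<le> norm (fst p, fst (snd p)) + norm (height p *\<^sub>R c)"
    unfolding offset_def by (rule norm_triangle_ineq4)
  also have "\<dots> \<le> norm p + norm p * norm c"
    using norm_fst_snd_le[of p] abs_height_le[of p] by (intro add_mono) (auto intro: mult_right_mono)
  finally show ?thesis by (simp add: algebra_simps)
qed

lemma norm_offset_dist_le: "norm (offset c p - offset c q) \<le> (1 + norm c) * dist p q"
  using norm_offset_le[of c "p - q"] by (simp add: offset_diff dist_norm)

lemma height_dist_le: "\<bar>height p - height q\<bar> \<le> dist p q"
  using abs_height_le[of "p - q"] by (simp add: dist_norm)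

lemma circ_cone_iff:
  "(x, y, t) \<in> circ_cone (a, b) \<longleftrightarrow> 0 \<le> t \<and> (x - t * a)^2 + (y - t * b)^2 = t^2 / 16"
proof -
  have "norm (u, v) = t / 4 \<longleftrightarrow> (norm (u, v))^2 = (t / 4)^2" if "t \<ge> 0" for u v :: real
    using that by (simp add: power2_eq_iff_nonneg)
  then show ?thesis
    by (auto simp: circ_cone_def offset_def norm_Pair power_divide)
qed

definition three_cones :: "nat \<Rightarrow> real \<times> real \<Rightarrow> real \<times> real \<Rightarrow> (real \<times> real \<times> real) set" where
  "three_cones k c c' = peanut k \<union> circ_cone c \<union> circ_cone c'"

lemma X1_eq: "X1 k = three_cones k (1, 1/2) (1, -1/2)"
  and X2_eq: "X2 k = three_cones k (1, 0) (-1, 0)"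
  by (auto simp: X1_def X2_def three_cones_def peanut_def peanut_fun_def circ_cone_iff)

text \<open>The product is \<open>t^k\<close> and the sum is \<open>2 * x^2 + 2 * y^2\<close>; if
  one factor were negative, the sum would make the other positive and the product negative.
  Geometrically, the peanut stays outside the open discs of radius \<open>t\<close> around
  \<open>(t, 0)\<close> and \<open>(-t, 0)\<close>.\<close>

lemma peanut_factors_nonneg:
  assumes "(x, y, t) \<in> peanut k"
  shows "x^2 - 2*x*t + y^2 \<ge> 0" "x^2 + 2*x*t + y^2 \<ge> 0"
proof -
  let ?A = "x^2 - 2*x*t + y^2" and ?B = "x^2 + 2*x*t + y^2"
  have AB: "?A * ?B = t^k" "t \<ge> 0" using assms by (auto simp: peanut_def peanut_fun_def)
  then have *: "?A * ?B \<ge> 0" by simp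
  have s: "?A + ?B \<ge> 0" by (simp add: algebra_simps)
  show "?A \<ge> 0" "?B \<ge> 0" using * s by (smt (verit) mult_neg_pos mult_pos_neg)+
qed

lemma norm_offset_peanut_ge:
  assumes "p \<in> peanut k" "c = (1, 0) \<or> c = (-1, 0)"
  shows "norm (offset c p) \<ge> height p"
proof -
  obtain x y t where p: "p = (x, y, t)" by (cases p)
  show ?thesis
    using assms(2) peanut_factors_nonneg[OF assms(1)[unfolded p]]
    by (auto simp: p offset_def norm_Pair power2_eq_square algebra_simps intro!: real_le_rsqrt)
qed

text \<open>With \<open>r = x^2 + y^2\<close> the equation reads
  \<open>r^2 = 4 * x^2 * t^2 + t^k\<close>, and \<open>t^k \<le> t^4\<close> for small heights, so
  \<open>r\<close> is at most \<open>5 * t^2\<close>. Norm and height are thus comparable, and germs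
  at the origin can be cut off by height.\<close>

lemma norm_peanut_le:
  assumes "k > 4" "p \<in> peanut k" "height p \<le> 1"
  shows "norm p \<le> 4 * height p"
proof -
  obtain x y t where p: "p = (x, y, t)" by (cases p)
  have t: "0 \<le> t" "t \<le> 1" and eq: "(x^2 - 2*x*t + y^2) * (x^2 + 2*x*t + y^2) = t^k"
    using assms by (auto simp: p peanut_def peanut_fun_def)
  define r where "r = x^2 + y^2"
  have r0: "r \<ge> 0" "x^2 \<le> r" by (auto simp: r_def)
  have "r * r = 4 * x^2 * t^2 + t^k" using eq by (simp add: r_def power2_eq_square algebra_simps)
  also have "\<dots> \<le> 4 * r * t^2 + t^2 * t^2"
    using power_decreasing[of 4 k t] assms(1) t r0
    by (intro add_mono mult_right_mono) (auto simp flip: power_add)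
  finally have *: "r * r \<le> 4 * r * t^2 + t^2 * t^2" .
  have "r \<le> 5 * t^2"
  proof (rule ccontr)
    assume "\<not> ?thesis"
    then have r: "r > 5 * t^2" "r > t^2" "r > 0"
      using zero_le_power2[of t] by linarith+
    have "r * r > r * (5 * t^2)" using r by (intro mult_strict_left_mono)
    moreover have "r * t^2 \<ge> t^2 * t^2" using r by (intro mult_right_mono) auto
    ultimately show False using * by (simp add: algebra_simps)
  qed
  then have "norm p \<le> sqrt (16 * t^2)"
    unfolding p norm_Pair r_def
    by (intro real_sqrt_le_mono) (use zero_le_power2[of t] in \<open>simp; linarith\<close>)
  then show ?thesis using t by (simp add: p real_sqrt_mult)
qed

lemma norm_circ_cone_le:
  assumes "p \<in> circ_cone c" "norm c \<le> 2"
  shows "norm p \<le> 4 * height p"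
proof -
  have "norm p \<le> height p / 4 + (norm c + 1) * height p"
    using norm_le_offset[of p c] assms(1) by (auto simp: circ_cone_def)
  also have "\<dots> \<le> height p / 4 + 3 * height p"
    using assms by (intro add_left_mono mult_right_mono) (auto simp: circ_cone_def)
  finally show ?thesis using assms by (auto simp: circ_cone_def)
qed

text \<open>The map \<open>offset c\<close> is 3-Lipschitz, and its norm is a quarter of the height
  at \<open>p\<close> but at least half of it at \<open>q\<close>. This gap costs a distance
  proportional to the heights; the constants are not sharp.\<close>

lemma circ_cone_separated:
  assumes "p \<in> circ_cone c" "norm c \<le> 2" "norm (offset c q) \<ge> height q / 2"
  shows "height p \<le> 17 * dist p q" "height q \<le> 16 * dist p q"
proof -
  have "norm (offset c q - offset c p) \<le> 3 * dist p q"
    using norm_offset_dist_le[of c q p] mult_right_mono[of "1 + norm c" 3 "dist p q"] assms(2)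
    by (simp add: dist_commute)
  moreover have "norm (offset c q) - norm (offset c p) \<le> norm (offset c q - offset c p)"
    by (rule norm_triangle_ineq2)
  ultimately show "height p \<le> 17 * dist p q" "height q \<le> 16 * dist p q"
    using assms(1,3) height_dist_le[of p q] by (auto simp: circ_cone_def)
qed

lemma norm_offset_circ_cone_ge:
  assumes "p \<in> circ_cone c'" "norm (c - c') \<ge> 3/4"
  shows "norm (offset c p) \<ge> height p / 2"
proof -
  have h: "height p \<ge> 0" "norm (offset c' p) = height p / 4" using assms by (auto simp: circ_cone_def)
  have "offset c' p - offset c p = height p *\<^sub>R (c - c')"
    by (simp add: offset_def algebra_simps)
  then have "norm (offset c' p) + norm (offset c p) \<ge> height p * norm (c - c')"
    using norm_triangle_ineq4[of "offset c' p" "offset c p"] h by simp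
  moreover have "height p * norm (c - c') \<ge> height p * (3/4)" using assms h by (intro mult_left_mono) auto
  ultimately show ?thesis using h by simp
qed

text \<open>Common to both surfaces, so that the separation estimates are proved once. The bound
  \<open>3/4\<close> on the centres leaves \<open>1/2\<close> after subtracting the radius
  \<open>1/4\<close> of the other circle.\<close>

definition admissible :: "nat \<Rightarrow> real \<times> real \<Rightarrow> real \<times> real \<Rightarrow> bool" where
  "admissible k c c' \<longleftrightarrow> norm c \<le> 2 \<and> norm c' \<le> 2 \<and> norm (c - c') \<ge> 3/4 \<and>
     (\<forall>p\<in>peanut k. norm (offset c p) \<ge> height p / 2 \<and> norm (offset c' p) \<ge> height p / 2)"

text \<open>The centres are at distance \<open>1/2\<close> from \<open>(1, 0)\<close>, and the
  peanut at scaled distance at least \<open>1\<close> from it; the triangle inequality leaves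
  \<open>1/2\<close>.\<close>

lemma admissible_X1: "admissible k (1, 1/2) (1, -1/2)"
proof -
  have "norm (offset (1, s) p) \<ge> height p / 2" if "p \<in> peanut k" "\<bar>s\<bar> = 1/2" for p s
  proof -
    have "height p \<ge> 0" using that by (simp add: peanut_def)
    moreover have "offset (1, 0) p - offset (1, s) p = height p *\<^sub>R (0, s)"
      by (simp add: offset_def)
    then have "norm (offset (1, 0) p) - norm (offset (1, s) p) \<le> norm (height p *\<^sub>R (0::real, s))"
      by (metis norm_triangle_ineq2)
    moreover have "norm (height p *\<^sub>R (0::real, s)) = height p / 2"
      using that \<open>height p \<ge> 0\<close> by (simp add: norm_Pair abs_mult)
    ultimately show ?thesis using norm_offset_peanut_ge[OF that(1), of "(1, 0)"] by auto
  qed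
  then show ?thesis
    by (auto simp: admissible_def norm_Pair power_divide intro!: real_le_lsqrt)
qed

lemma admissible_X2: "admissible k (1, 0) (-1, 0)"
proof -
  have "norm (offset c p) \<ge> height p / 2" if "p \<in> peanut k" "c = (1, 0) \<or> c = (-1, 0)" for p c
    using norm_offset_peanut_ge[OF that] that(1) by (simp add: peanut_def)
  then show ?thesis by (auto simp: admissible_def norm_Pair)
qed

section \<open>Outer bi-Lipschitz equivalence\<close>

text \<open>The order of the cases does not matter for admissible centres: the pieces meet only at
  height 0, where every shear is the identity.\<close>

definition relocate ::
  "real \<times> real \<Rightarrow> real \<times> real \<Rightarrow> real \<times> real \<Rightarrow> real \<times> real \<Rightarrow> real \<times> real \<times> real \<Rightarrow> real \<times> real \<times> real" where
  "relocate c c' d d' p =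
     (if p \<in> circ_cone c then shear (d - c) p
      else if p \<in> circ_cone c' then shear (d' - c') p else p)"

lemma zero_in_peanut: "k > 4 \<Longrightarrow> 0 \<in> peanut k"
  by (simp add: peanut_def peanut_fun_def zero_prod_def)

lemma shear_circ_cone: "shear (d - c) p \<in> circ_cone d \<longleftrightarrow> p \<in> circ_cone c"
  using offset_shear[of c "d - c" p] by (simp add: circ_cone_def)

lemma shear_inverse: "shear (c - d) (shear (d - c) p) = p"
  by (simp add: shear_def height_def prod_eq_iff algebra_simps)

lemma shear_height_zero: "height p = 0 \<Longrightarrow> shear v p = p"
  by (simp add: shear_def height_def prod_eq_iff)

lemma shear_dist_le: "dist (shear v p) (shear v q) \<le> (1 + norm v) * dist p q"
proof -
  let ?w = "height (p - q)"
  have "shear v p - shear v q = (p - q) + ?w *\<^sub>R (fst v, snd v, 0)"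
    by (simp add: shear_def height_def prod_eq_iff algebra_simps)
  then have "norm (shear v p - shear v q) \<le> norm (p - q) + \<bar>?w\<bar> * norm (fst v, snd v, 0::real)"
    by (metis norm_scaleR norm_triangle_ineq real_norm_def)
  also have "norm (fst v, snd v, 0::real) = norm v"
    by (cases v) (simp add: norm_Pair)
  also have "\<bar>?w\<bar> * norm v \<le> norm (p - q) * norm v"
    by (intro mult_right_mono abs_height_le) auto
  finally show ?thesis by (simp add: dist_norm algebra_simps)
qed

lemma norm_three_cones_le:
  assumes "k > 4" "admissible k c c'" "p \<in> three_cones k c c'" "height p \<le> 1"
  shows "norm p \<le> 4 * height p"
  using assms(3) norm_peanut_le[OF assms(1) _ assms(4)]
    norm_circ_cone_le[of p c] norm_circ_cone_le[of p c'] assms(2)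
  by (auto simp: three_cones_def admissible_def)

lemma three_cones_separated:
  assumes "admissible k c c'" "p \<in> circ_cone c" "q \<in> peanut k \<union> circ_cone c'"
  shows "height p \<le> 17 * dist p q" "height q \<le> 17 * dist p q"
proof -
  have "norm (offset c q) \<ge> height q / 2"
    using assms norm_offset_circ_cone_ge[of q c' c] by (auto simp: admissible_def)
  then show "height p \<le> 17 * dist p q" "height q \<le> 17 * dist p q"
    using circ_cone_separated[OF assms(2), of q] assms(1) zero_le_dist[of p q]
    unfolding admissible_def by linarith+
qed

lemma admissible_sym: "admissible k c c' \<Longrightarrow> admissible k c' c"
  by (auto simp: admissible_def norm_minus_commute)

lemma three_cones_disjoint:
  assumes "admissible k c c'" "p \<in> circ_cone c" "p \<in> peanut k \<union> circ_cone c'"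
  shows "height p = 0"
  using three_cones_separated[OF assms] assms(2) by (auto simp: circ_cone_def)

lemma height_relocate [simp]: "height (relocate c c' d d' p) = height p"
  by (simp add: relocate_def)

lemma relocate_in_three_cones:
  "p \<in> three_cones k c c' \<Longrightarrow> relocate c c' d d' p \<in> three_cones k d d'"
  by (auto simp: relocate_def three_cones_def shear_circ_cone)

lemma relocate_circ_cone1: "p \<in> circ_cone c \<Longrightarrow> relocate c c' d d' p = shear (d - c) p"
  by (simp add: relocate_def)

lemma relocate_circ_cone2:
  assumes "admissible k c c'" "p \<in> circ_cone c'"
  shows "relocate c c' d d' p = shear (d' - c') p"
  using three_cones_disjoint[OF assms(1), of p] assms(2)
  by (auto simp: relocate_def shear_height_zero)

lemma relocate_peanut:
  assumes "admissible k c c'" "p \<in> peanut k"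
  shows "relocate c c' d d' p = p"
  using three_cones_disjoint[OF assms(1), of p]
    three_cones_disjoint[OF admissible_sym[OF assms(1)], of p] assms(2)
  by (auto simp: relocate_def shear_height_zero)

lemma relocate_inverse:
  assumes "admissible k c c'" "admissible k d d'" "p \<in> three_cones k c c'"
  shows "relocate d d' c c' (relocate c c' d d' p) = p"
  using assms(3) unfolding three_cones_def
  by (auto simp: relocate_circ_cone1 relocate_circ_cone2[OF assms(1)] relocate_circ_cone2[OF assms(2)]
        relocate_peanut[OF assms(1)] relocate_peanut[OF assms(2)] shear_circ_cone shear_inverse)

text \<open>On a single piece the map is the identity or a shear by a vector of norm at most 4. For
  points of different pieces both heights are at most 17 times the distance and the images have norm
  at most 4 times the height, whence \<open>136 = 2 * 4 * 17\<close>.\<close>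

lemma relocate_lipschitz:
  assumes k: "k > 4" and c: "admissible k c c'" and d: "admissible k d d'"
    and p: "p \<in> three_cones k c c'" "height p \<le> 1"
    and q: "q \<in> three_cones k c c'" "height q \<le> 1"
  shows "dist (relocate c c' d d' p) (relocate c c' d d' q) \<le> 136 * dist p q"
proof -
  let ?h = "relocate c c' d d'"
  have apart: ?thesis if "height p \<le> 17 * dist p q" "height q \<le> 17 * dist p q"
  proof -
    have "norm (?h p) \<le> 4 * height p" "norm (?h q) \<le> 4 * height q"
      using norm_three_cones_le[OF k d relocate_in_three_cones[OF p(1)]]
        norm_three_cones_le[OF k d relocate_in_three_cones[OF q(1)]] p(2) q(2) by auto
    then show ?thesis
      using that norm_triangle_ineq4[of "?h p" "?h q"] by (simp add: dist_norm)
  qed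
  have sheared: "dist (shear v p) (shear v q) \<le> 136 * dist p q" if "norm v \<le> 4" for v
    using shear_dist_le[of v p q] mult_right_mono[of "1 + norm v" 136 "dist p q"] that by simp
  have n: "norm (d - c) \<le> 4" "norm (d' - c') \<le> 4"
    using norm_triangle_ineq4[of d c] norm_triangle_ineq4[of d' c'] c d
    by (auto simp: admissible_def)
  note sep = three_cones_separated[OF c] three_cones_separated[OF admissible_sym[OF c]]
  consider "p \<in> peanut k" "q \<in> peanut k" | "p \<in> circ_cone c" "q \<in> circ_cone c"
    | "p \<in> circ_cone c'" "q \<in> circ_cone c'"
    | "p \<in> circ_cone c" "q \<in> peanut k \<union> circ_cone c'"
    | "q \<in> circ_cone c" "p \<in> peanut k \<union> circ_cone c'"
    | "p \<in> circ_cone c'" "q \<in> peanut k \<union> circ_cone c"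
    | "q \<in> circ_cone c'" "p \<in> peanut k \<union> circ_cone c"
    using p(1) q(1) by (auto simp: three_cones_def)
  then show ?thesis
  proof cases
    case 1
    then show ?thesis using relocate_peanut[OF c] by simp
  next
    case 2
    then show ?thesis using sheared[OF n(1)] by (simp add: relocate_circ_cone1)
  next
    case 3
    then show ?thesis using sheared[OF n(2)] by (simp add: relocate_circ_cone2[OF c])
  next
    case 4
    then show ?thesis using sep(1,2) by (intro apart) auto
  next
    case 5
    then show ?thesis using sep(1,2)[of q p] by (intro apart) (auto simp: dist_commute)
  next
    case 6
    then show ?thesis using sep(3,4)[of p q] by (intro apart) auto
  next
    case 7
    then show ?thesis using sep(3,4)[of q p] by (intro apart) (auto simp: dist_commute)
  qed
qed

lemma open_height_less: "open {p. height p < r}"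
  unfolding height_def by (intro open_Collect_less continuous_intros)

text \<open>The inverse is \<open>relocate\<close> with the centres exchanged, so one Lipschitz
  estimate gives both bounds.\<close>

proposition outer_lipschitz_equiv_three_cones:
  assumes k: "k > 4" and c: "admissible k c c'" and d: "admissible k d d'"
  shows "outer_lipschitz_equiv (three_cones k c c') (three_cones k d d')"
proof -
  let ?U = "{p. height p < 1}"
  let ?X = "three_cones k c c' \<inter> ?U" and ?Y = "three_cones k d d' \<inter> ?U"
  let ?h = "relocate c c' d d'" and ?g = "relocate d d' c c'"
  have lip_h: "dist (?h p) (?h q) \<le> 136 * dist p q" if "p \<in> ?X" "q \<in> ?X" for p q
    using that by (intro relocate_lipschitz[OF k c d]) auto
  have lip_g: "dist (?g p) (?g q) \<le> 136 * dist p q" if "p \<in> ?Y" "q \<in> ?Y" for p q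
    using that by (intro relocate_lipschitz[OF k d c]) auto
  have "136-lipschitz_on ?X ?h" "136-lipschitz_on ?Y ?g"
    using lip_h lip_g by (auto intro!: lipschitz_onI)
  then have cont: "continuous_on ?X ?h" "continuous_on ?Y ?g"
    by (auto intro: lipschitz_on_continuous_on)
  have into: "?h p \<in> ?Y" if "p \<in> ?X" for p using that by (simp add: relocate_in_three_cones)
  have into': "?g p \<in> ?X" if "p \<in> ?Y" for p using that by (simp add: relocate_in_three_cones)
  have gh: "?g (?h p) = p" if "p \<in> ?X" for p using relocate_inverse[OF c d] that by auto
  have hg: "?h (?g p) = p" if "p \<in> ?Y" for p using relocate_inverse[OF d c] that by auto
  have "homeomorphism ?X ?Y ?h ?g"
    using cont into into' gh hg by (intro homeomorphismI) blast+
  moreover have "?h 0 = 0" using relocate_peanut[OF c] zero_in_peanut[OF k] by simp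
  moreover have "dist p q \<le> 136 * dist (?h p) (?h q)" if "p \<in> ?X" "q \<in> ?X" for p q
    using lip_g[OF into into, OF that] gh that by simp
  ultimately show ?thesis
    unfolding outer_lipschitz_equiv_def using lip_h open_height_less[of 1]
    by (intro exI[of _ ?U] exI[of _ ?h] exI[of _ ?g] exI[of _ "136::real"]) auto
qed

section \<open>Ambient topological equivalence\<close>

definition clip :: "real \<Rightarrow> real \<Rightarrow> real \<Rightarrow> real" where
  "clip a b x = max 0 (min (b - a) (x - a))"

text \<open>The piecewise linear map that fixes everything outside the interval from \<open>p\<close> to \<open>q\<close>
and sends \<open>a\<close> to \<open>a'\<close> and \<open>b\<close> to \<open>b'\<close>; the clipped form makes it visibly continuous in
the breakpoints, too, which will depend on the height.\<close>

definition pwl :: "real \<Rightarrow> real \<Rightarrow> real \<Rightarrow> real \<Rightarrow> real \<Rightarrow> real \<Rightarrow> real \<Rightarrow> real" where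
  "pwl p a b q a' b' x = min x p + (a' - p) / (a - p) * clip p a x
     + (b' - a') / (b - a) * clip a b x + (q - b') / (q - b) * clip b q x + (max x q - q)"

definition cutoff :: "real \<Rightarrow> real \<Rightarrow> real \<Rightarrow> real \<Rightarrow> real \<Rightarrow> real" where
  "cutoff p a b q x = max 0 (min 1 (min ((x - p) / (a - p)) ((q - x) / (q - b))))"

text \<open>Interpolates in \<open>u\<close> between the identity and \<open>pwl\<close>, with a
  trapezoid in \<open>v\<close> as weight: an inner box is moved affinely, and nothing moves outside
  the outer box.\<close>

definition box_slide ::
  "real \<Rightarrow> real \<Rightarrow> real \<Rightarrow> real \<Rightarrow> real \<Rightarrow> real \<Rightarrow> real \<Rightarrow> real \<Rightarrow> real \<Rightarrow> real \<Rightarrow> real \<Rightarrow> real \<Rightarrow> real" where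
  "box_slide p a b q a' b' r c d s u v = u + cutoff r c d s v * (pwl p a b q a' b' u - u)"

lemma pwl_outside:
  assumes "p < a" "a < b" "b < q" "x \<le> p \<or> q \<le> x"
  shows "pwl p a b q a' b' x = x"
  using assms by (auto simp: pwl_def clip_def min_def max_def)

lemma pwl_middle:
  assumes "p < a" "a < b" "b < q" "a \<le> x" "x \<le> b"
  shows "pwl p a b q a' b' x = a' + (x - a) * ((b' - a') / (b - a))"
  using assms by (auto simp: pwl_def clip_def min_def max_def)

text \<open>The identity is the sum of the same clipped pieces with all slopes 1. Comparing term by
  term, \<open>pwl\<close> grows at least by the smallest slope times \<open>y - x\<close>.\<close>

lemma pwl_strict_mono:
  assumes "p < a" "a < b" "b < q" "p < a'" "a' < b'" "b' < q"
  shows "strict_mono (pwl p a b q a' b')"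
proof (rule strict_monoI)
  fix x y :: real assume xy: "x < y"
  have sum: "z = min z p + clip p a z + clip a b z + clip b q z + (max z q - q)" for z
    using assms by (auto simp: clip_def min_def max_def)
  define m1 m2 m3 where "m1 = (a' - p) / (a - p)" "m2 = (b' - a') / (b - a)" "m3 = (q - b') / (q - b)"
  have m: "0 < m1" "0 < m2" "0 < m3" using assms by (auto simp: m1_m2_m3_def)
  define m where "m = Min {1, m1, m2, m3}"
  have m': "0 < m" "m \<le> 1" "m \<le> m1" "m \<le> m2" "m \<le> m3" using m by (auto simp: m_def)
  have mono: "clip c d x \<le> clip c d y" for c d using xy by (auto simp: clip_def)
  have *: "m * (B - A) \<le> n * (B - A)" if "m \<le> n" "A \<le> B" for n A B
    using that by (intro mult_right_mono) auto
  have "0 < m * (y - x)" using m' xy by simp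
  also have "y - x = (min y p - min x p) + (clip p a y - clip p a x) + (clip a b y - clip a b x)
      + (clip b q y - clip b q x) + (max y q - max x q)"
    using sum[of x] sum[of y] by linarith
  also have "m * \<dots> = m * (min y p - min x p) + m * (clip p a y - clip p a x)
      + m * (clip a b y - clip a b x) + m * (clip b q y - clip b q x) + m * (max y q - max x q)"
    by (simp add: algebra_simps)
  also have "\<dots> \<le> 1 * (min y p - min x p) + m1 * (clip p a y - clip p a x)
      + m2 * (clip a b y - clip a b x) + m3 * (clip b q y - clip b q x) + 1 * (max y q - max x q)"
    using m' xy mono by (intro add_mono *) auto
  also have "\<dots> = pwl p a b q a' b' y - pwl p a b q a' b' x"
    by (simp add: pwl_def m1_m2_m3_def algebra_simps)
  finally show "pwl p a b q a' b' x < pwl p a b q a' b' y" by simp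
qed

lemma cutoff_range: "0 \<le> cutoff p a b q x" "cutoff p a b q x \<le> 1"
  by (auto simp: cutoff_def)

lemma cutoff_zero:
  assumes "p < a" "b < q" "x \<le> p \<or> q \<le> x"
  shows "cutoff p a b q x = 0"
proof -
  have "(x - p) / (a - p) \<le> 0 \<or> (q - x) / (q - b) \<le> 0"
    using assms by (auto intro: divide_nonpos_pos)
  then show ?thesis by (auto simp: cutoff_def)
qed

lemma cutoff_one: "\<lbrakk>p < a; b < q; a \<le> x; x \<le> b\<rbrakk> \<Longrightarrow> cutoff p a b q x = 1"
  by (auto simp: cutoff_def min_def max_def divide_simps)

lemma box_slide_outside:
  assumes "p < a" "a < b" "b < q" "r < c" "d < s" "u \<le> p \<or> q \<le> u \<or> v \<le> r \<or> s \<le> v"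
  shows "box_slide p a b q a' b' r c d s u v = u"
  using assms pwl_outside[of p a b q u] cutoff_zero[of r c d s v] by (auto simp: box_slide_def)

lemma box_slide_core:
  assumes "p < a" "a < b" "b < q" "r < c" "d < s" "a \<le> u" "u \<le> b" "c \<le> v" "v \<le> d"
  shows "box_slide p a b q a' b' r c d s u v = a' + (u - a) * ((b' - a') / (b - a))"
  using assms pwl_middle[of p a b q u] cutoff_one[of r c d s v] by (auto simp: box_slide_def)

text \<open>For fixed \<open>v\<close> the map is a convex combination of the identity and a
  strictly increasing map.\<close>

lemma box_slide_inj:
  assumes "p < a" "a < b" "b < q" "p < a'" "a' < b'" "b' < q"
  shows "inj (\<lambda>u. box_slide p a b q a' b' r c d s u v)"
proof -
  let ?\<chi> = "cutoff r c d s v" and ?\<phi> = "pwl p a b q a' b'"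
  have "strict_mono (\<lambda>u. box_slide p a b q a' b' r c d s u v)"
  proof (rule strict_monoI)
    fix x y :: real assume xy: "x < y"
    then have \<phi>: "?\<phi> x < ?\<phi> y" using pwl_strict_mono[OF assms] by (simp add: strict_mono_def)
    have eq: "box_slide p a b q a' b' r c d s z v = (1 - ?\<chi>) * z + ?\<chi> * ?\<phi> z" for z
      by (simp add: box_slide_def algebra_simps)
    show "box_slide p a b q a' b' r c d s x v < box_slide p a b q a' b' r c d s y v"
    proof (cases "?\<chi> = 1")
      case True
      then show ?thesis using \<phi> by (simp add: eq)
    next
      case False
      then have "(1 - ?\<chi>) * x < (1 - ?\<chi>) * y"
        using xy cutoff_range(2)[of r c d s v] by (intro mult_strict_left_mono) auto
      moreover have "?\<chi> * ?\<phi> x \<le> ?\<chi> * ?\<phi> y" using \<phi> by (intro mult_left_mono cutoff_range) auto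
      ultimately show ?thesis by (simp add: eq)
    qed
  qed
  then show ?thesis by (rule strict_mono_imp_inj_on)
qed

text \<open>\<open>pwl\<close> maps the interval from \<open>p\<close> to \<open>q\<close> into
  itself. A bound independent of the inner breakpoints is needed for continuity at height 0, where
  the neck closes.\<close>

lemma box_slide_displacement:
  assumes "p < a" "a < b" "b < q" "p < a'" "a' < b'" "b' < q"
  shows "\<bar>box_slide p a b q a' b' r c d s u v - u\<bar> \<le> q - p"
proof -
  let ?\<phi> = "pwl p a b q a' b'"
  have "\<bar>?\<phi> u - u\<bar> \<le> q - p"
  proof (cases "p \<le> u \<and> u \<le> q")
    case True
    then have "?\<phi> p \<le> ?\<phi> u" "?\<phi> u \<le> ?\<phi> q"
      using pwl_strict_mono[OF assms] by (auto simp: strict_mono_less_eq)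
    then show ?thesis using True pwl_outside[OF assms(1-3)] by (auto simp: abs_le_iff)
  next
    case False
    then show ?thesis using pwl_outside[OF assms(1-3), of u] assms by auto
  qed
  then have "\<bar>cutoff r c d s v\<bar> * \<bar>?\<phi> u - u\<bar> \<le> 1 * (q - p)"
    using cutoff_range[of r c d s v] by (intro mult_mono) auto
  then show ?thesis by (simp add: box_slide_def abs_mult)
qed

lemma box_slide_continuous:
  assumes "continuous_on S a" "continuous_on S b" "continuous_on S a'" "continuous_on S b'"
    "continuous_on S r" "continuous_on S c" "continuous_on S d" "continuous_on S s"
    "continuous_on S u" "continuous_on S v"
    "\<And>z. z \<in> S \<Longrightarrow> p < a z \<and> a z < b z \<and> b z < q \<and> r z < c z \<and> d z < s z"
  shows "continuous_on S (\<lambda>z. box_slide p (a z) (b z) q (a' z) (b' z) (r z) (c z) (d z) (s z) (u z) (v z))"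
proof -
  have "a z - p \<noteq> 0" "b z - a z \<noteq> 0" "q - b z \<noteq> 0" "c z - r z \<noteq> 0" "s z - d z \<noteq> 0" if "z \<in> S" for z
    using assms(11)[OF that] by auto
  then show ?thesis
    unfolding box_slide_def pwl_def clip_def cutoff_def
    by (intro continuous_intros assms ballI) auto
qed

section \<open>Lifting level maps to space\<close>

definition slide_x :: "(real \<Rightarrow> real \<Rightarrow> real \<Rightarrow> real) \<Rightarrow> real \<times> real \<times> real \<Rightarrow> real \<times> real \<times> real" where
  "slide_x f = (\<lambda>(x, y, t). (if t > 0 then t * f t (x / t) (y / t) else x, y, t))"

definition slide_y :: "(real \<Rightarrow> real \<Rightarrow> real \<Rightarrow> real) \<Rightarrow> real \<times> real \<times> real \<Rightarrow> real \<times> real \<times> real" where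
  "slide_y f = (\<lambda>(x, y, t). (x, if t > 0 then t * f t (y / t) (x / t) else y, t))"

lemma slide_level:
  assumes "t > 0"
  shows "slide_x f (t * u, t * v, t) = (t * f t u v, t * v, t)"
    and "slide_y f (t * u, t * v, t) = (t * u, t * f t v u, t)"
  using assms by (auto simp: slide_x_def slide_y_def)

lemma slide_nonpos:
  assumes "height p \<le> 0"
  shows "slide_x f p = p" "slide_y f p = p"
  using assms by (auto simp: slide_x_def slide_y_def height_def split: prod.splits)

lemma height_slide [simp]: "height (slide_x f p) = height p" "height (slide_y f p) = height p"
  by (auto simp: slide_x_def slide_y_def height_def split: prod.splits)

text \<open>The bound makes \<open>e\<close> vanish at heights at most 0 and squeezes it to 0 on
  approach to them.\<close>

lemma continuous_extend_by_zero:
  fixes e :: "real \<times> real \<times> real \<Rightarrow> real"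
  assumes cont: "continuous_on {p. height p > 0} e"
    and bound: "\<And>p. \<bar>e p\<bar> \<le> C * max 0 (height p)"
  shows "continuous_on UNIV e"
proof (rule continuous_at_imp_continuous_on, rule ballI)
  fix p :: "real \<times> real \<times> real"
  have op: "open {p. height p > 0}"
    unfolding height_def by (intro open_Collect_less continuous_intros)
  show "isCont e p"
  proof (cases "height p > 0")
    case True
    then show ?thesis using cont continuous_on_eq_continuous_at[OF op, of e] by blast
  next
    case False
    have "isCont (\<lambda>q. C * max 0 (height q)) p"
      unfolding height_def by (intro continuous_intros)
    then have "((\<lambda>q. C * max 0 (height q)) \<longlongrightarrow> 0) (at p)"
      using False by (simp add: isCont_def)
    then have "(e \<longlongrightarrow> 0) (at p)"
      by (rule Lim_null_comparison[rotated]) (use bound in auto)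
    moreover have "e p = 0" using bound[of p] False by simp
    ultimately show ?thesis by (simp add: isCont_def)
  qed
qed

lemma slide_x_continuous:
  assumes cont: "continuous_on {(t, u, v). 0 < t} (\<lambda>(t, u, v). f t u v)"
    and bound: "\<And>t u v. 0 < t \<Longrightarrow> \<bar>f t u v - u\<bar> \<le> C"
  shows "continuous_on UNIV (slide_x f)"
proof -
  define e where "e = (\<lambda>p. if height p > 0 then height p * f (height p) (fst p / height p) (fst (snd p) / height p) - fst p else 0)"
  have "continuous_on {p. height p > 0}
      (\<lambda>p. (\<lambda>(t, u, v). f t u v) (height p, fst p / height p, fst (snd p) / height p))"
    by (rule continuous_on_compose2[OF cont])
      (auto simp: height_def intro!: continuous_intros)
  then have "continuous_on {p. height p > 0}
      (\<lambda>p. height p * f (height p) (fst p / height p) (fst (snd p) / height p) - fst p)"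
    by (auto simp: height_def intro!: continuous_intros)
  then have e1: "continuous_on {p. height p > 0} e"
    by (rule continuous_on_eq) (auto simp: e_def)
  have e2: "\<bar>e p\<bar> \<le> C * max 0 (height p)" for p
  proof (cases "height p > 0")
    case True
    have "e p = height p * (f (height p) (fst p / height p) (fst (snd p) / height p) - fst p / height p)"
      using True by (simp add: e_def algebra_simps)
    then show ?thesis using mult_left_mono[OF bound[OF True], of "height p"] True
      by (simp add: abs_mult mult.commute)
  next
    case False
    then show ?thesis by (simp add: e_def)
  qed
  have "slide_x f = (\<lambda>p. (fst p + e p, fst (snd p), snd (snd p)))"
    by (auto simp: slide_x_def e_def fun_eq_iff)
  then show ?thesis
    using continuous_extend_by_zero[OF e1 e2] by (auto intro!: continuous_intros)
qed

lemma slide_y_conj: "slide_y f = (\<lambda>(x, y, t). (y, x, t)) \<circ> slide_x f \<circ> (\<lambda>(x, y, t). (y, x, t))"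
  by (auto simp: slide_x_def slide_y_def fun_eq_iff)

lemma slide_y_continuous:
  assumes "continuous_on {(t, u, v). 0 < t} (\<lambda>(t, u, v). f t u v)"
    and "\<And>t u v. 0 < t \<Longrightarrow> \<bar>f t u v - u\<bar> \<le> C"
  shows "continuous_on UNIV (slide_y f)"
proof -
  have "continuous_on UNIV (\<lambda>(x, y, t). (y, x, t) :: real \<times> real \<times> real)"
    by (auto simp: case_prod_unfold intro!: continuous_intros)
  then show ?thesis
    unfolding slide_y_conj using slide_x_continuous[OF assms]
    by (intro continuous_on_compose) (auto intro: continuous_on_subset)
qed

lemma slide_x_inj:
  assumes "\<And>t v. 0 < t \<Longrightarrow> inj (\<lambda>u. f t u v)"
  shows "inj (slide_x f)"
proof (rule injI)
  fix p q assume *: "slide_x f p = slide_x f q"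
  obtain x y t where p: "p = (x, y, t)" by (cases p)
  obtain x' where q: "q = (x', y, t)" using * by (cases q) (auto simp: slide_x_def p)
  show "p = q"
    using * injD[OF assms, of t "x / t" "y / t" "x' / t"]
    by (cases "t > 0") (auto simp: p q slide_x_def)
qed

lemma slide_y_inj:
  assumes "\<And>t v. 0 < t \<Longrightarrow> inj (\<lambda>u. f t u v)"
  shows "inj (slide_y f)"
proof -
  have "inj (\<lambda>(x, y, t). (y, x, t) :: real \<times> real \<times> real)" by (auto simp: inj_def)
  then show ?thesis unfolding slide_y_conj using slide_x_inj[OF assms] by (intro inj_compose)
qed

text \<open>Invariance of domain supplies the open image and the continuous inverse. On each piece
  \<open>H\<close> is an explicit bijection onto the target piece, so by injectivity no other point
  can be mapped there.\<close>

lemma ambient_topo_equiv_three_cones: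
  assumes k: "k > 4" and cont: "continuous_on UNIV H" and inj: "inj H"
    and ht: "\<And>p. height (H p) = height p"
    and peanut: "\<And>p. p \<in> peanut k \<Longrightarrow> height p < 1 \<Longrightarrow> H p = p"
    and c: "\<And>p. p \<in> circ_cone c \<Longrightarrow> H p = shear (d - c) p"
    and c': "\<And>p. p \<in> circ_cone c' \<Longrightarrow> H p = shear (d' - c') p"
  shows "ambient_topo_equiv (three_cones k c c') (three_cones k d d')"
proof -
  let ?U = "{p. height p < 1}"
  have opU: "open ?U" by (rule open_height_less)
  have contU: "continuous_on ?U H" and injU: "inj_on H ?U"
    using cont inj by (auto intro: continuous_on_subset inj_on_subset)
  obtain g where g: "homeomorphism ?U (H ` ?U) H g"
    using invariance_of_domain_homeomorphism[OF opU contU _ injU] by auto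
  have opV: "open (H ` ?U)" by (rule invariance_of_domain[OF contU opU injU])
  have H0: "H 0 = 0" using peanut zero_in_peanut[OF k] by simp
  have "H p \<in> three_cones k d d'" if "p \<in> three_cones k c c'" "height p < 1" for p
    using that peanut[of p] c[of p] c'[of p] by (auto simp: three_cones_def shear_circ_cone)
  moreover have "p \<in> three_cones k c c'" if "H p \<in> three_cones k d d'" "height p < 1" for p
  proof -
    have *: "p \<in> circ_cone a"
      if "H p \<in> circ_cone b" "\<And>p. p \<in> circ_cone a \<Longrightarrow> H p = shear (b - a) p" for a b
    proof -
      have a: "shear (a - b) (H p) \<in> circ_cone a" using that(1) by (simp add: shear_circ_cone)
      then have "H (shear (a - b) (H p)) = H p" using that(2) by (simp add: shear_inverse)
      then show ?thesis using a injD[OF inj] by metis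
    qed
    have "p \<in> peanut k" if "H p \<in> peanut k"
    proof -
      have "H (H p) = H p" using peanut[OF that] \<open>height p < 1\<close> by (simp add: ht)
      then show ?thesis using that injD[OF inj] by metis
    qed
    then show ?thesis using that(1) *[OF _ c] *[OF _ c'] unfolding three_cones_def by blast
  qed
  ultimately have img: "H ` (three_cones k c c' \<inter> ?U) = three_cones k d d' \<inter> H ` ?U" by blast
  have "0 \<in> H ` ?U" using H0 by (intro image_eqI[of _ _ 0]) simp_all
  then show ?thesis
    unfolding ambient_topo_equiv_def using opU opV g H0 img
    by (intro exI[of _ ?U] exI[of _ "H ` ?U"] exI[of _ H] exI[of _ g] conjI) simp_all
qed

text \<open>For \<open>t < 1\<close> this is at most the half-width \<open>t powr ((k - 4) / 4)\<close> of the neck in level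
coordinates, and it needs no roots.\<close>

definition neck :: "nat \<Rightarrow> real \<Rightarrow> real" where
  "neck k t = min (1/10) (t ^ (k - 4))"

lemma neck_pos: "0 < t \<Longrightarrow> 0 < neck k t" and neck_le: "neck k t \<le> 1/10"
  by (auto simp: neck_def)

text \<open>In level coordinates the peanut meets the line \<open>u = 0\<close> where
  \<open>v^4 = t^(k - 4)\<close>; the bound keeps the strip of half-width \<open>neck k t\<close>
  inside.\<close>

lemma neck_power4_le:
  assumes "0 < t" "t \<le> 1"
  shows "neck k t ^ 4 \<le> t ^ (k - 4)"
proof -
  have "neck k t ^ 4 \<le> neck k t ^ 1"
    using neck_pos[OF assms(1)] neck_le[of k t] by (intro power_decreasing) (auto intro: less_imp_le)
  then show ?thesis by (simp add: neck_def)
qed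

text \<open>In the level coordinates \<open>u = x / t\<close>, \<open>v = y / t\<close> the circle around \<open>(1, -1/2)\<close> is first
narrowed and pushed to the left, then flattened to the width of the neck around \<open>v = 0\<close>, then
pushed through the neck into the other lobe, and finally restored to its round shape around
\<open>(-1, 0)\<close>; the last slide lowers the circle around \<open>(1, 1/2)\<close>. Every slide moves only points
of a box inside the peanut.\<close>

definition slide1 :: "real \<Rightarrow> real \<Rightarrow> real \<Rightarrow> real" where
  "slide1 t = box_slide 0.4 0.75 1.25 1.6 0.45 0.65 (-0.79) (-0.75) (-0.25) (-0.21)"

definition slide2 :: "nat \<Rightarrow> real \<Rightarrow> real \<Rightarrow> real \<Rightarrow> real" where
  "slide2 k t = box_slide (-0.8) (-0.75) (-0.25) 0.8 (- neck k t / 2) (neck k t / 2) 0.42 0.45 0.65 0.7"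

definition slide3 :: "nat \<Rightarrow> real \<Rightarrow> real \<Rightarrow> real \<Rightarrow> real" where
  "slide3 k t = box_slide (-1.5) 0.45 0.65 0.7 (-1.25) (-0.75)
     (- neck k t) (- neck k t / 2) (neck k t / 2) (neck k t)"

definition slide4 :: "nat \<Rightarrow> real \<Rightarrow> real \<Rightarrow> real \<Rightarrow> real" where
  "slide4 k t = box_slide (-0.8) (- neck k t / 2) (neck k t / 2) 0.8 (-0.25) 0.25 (-1.3) (-1.25) (-0.75) (-0.7)"

definition slide5 :: "real \<Rightarrow> real \<Rightarrow> real \<Rightarrow> real" where
  "slide5 t = box_slide (-0.8) 0.25 0.75 0.8 (-0.25) 0.25 0.7 0.75 1.25 1.3"

lemmas slide_defs = slide1_def slide2_def slide3_def slide4_def slide5_def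

definition unlink :: "nat \<Rightarrow> real \<times> real \<times> real \<Rightarrow> real \<times> real \<times> real" where
  "unlink k = slide_y slide5 \<circ> slide_y (slide4 k) \<circ> slide_x (slide3 k) \<circ> slide_y (slide2 k) \<circ> slide_x slide1"

section \<open>Moving one circle through the neck\<close>

lemma slide_continuous:
  "continuous_on {(t, u, v). 0 < t} (\<lambda>(t, u, v). slide1 t u v)"
  "continuous_on {(t, u, v). 0 < t} (\<lambda>(t, u, v). slide2 k t u v)"
  "continuous_on {(t, u, v). 0 < t} (\<lambda>(t, u, v). slide3 k t u v)"
  "continuous_on {(t, u, v). 0 < t} (\<lambda>(t, u, v). slide4 k t u v)"
  "continuous_on {(t, u, v). 0 < t} (\<lambda>(t, u, v). slide5 t u v)"
proof -
  have n: "continuous_on S (\<lambda>z. neck k (fst z))" for S :: "(real \<times> real \<times> real) set"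
    unfolding neck_def by (intro continuous_intros)
  have b: "0 < neck k t \<and> neck k t < 0.2" if "0 < t" for t
    using neck_pos[OF that, of k] neck_le[of k t] by simp
  show "continuous_on {(t, u, v). 0 < t} (\<lambda>(t, u, v). slide1 t u v)"
    "continuous_on {(t, u, v). 0 < t} (\<lambda>(t, u, v). slide2 k t u v)"
    "continuous_on {(t, u, v). 0 < t} (\<lambda>(t, u, v). slide3 k t u v)"
    "continuous_on {(t, u, v). 0 < t} (\<lambda>(t, u, v). slide4 k t u v)"
    "continuous_on {(t, u, v). 0 < t} (\<lambda>(t, u, v). slide5 t u v)"
    unfolding slide_defs case_prod_unfold
    by (intro box_slide_continuous continuous_intros n; use b in fastforce)+
qed

lemma slide_displacement:
  assumes "0 < t"
  shows "\<bar>slide1 t u v - u\<bar> \<le> 3" "\<bar>slide2 k t u v - u\<bar> \<le> 3" "\<bar>slide3 k t u v - u\<bar> \<le> 3"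
    "\<bar>slide4 k t u v - u\<bar> \<le> 3" "\<bar>slide5 t u v - u\<bar> \<le> 3"
  unfolding slide_defs using neck_pos[OF assms, of k] neck_le[of k t]
  by (auto intro!: order_trans[OF box_slide_displacement])

lemma slide_inj:
  assumes "0 < t"
  shows "inj (\<lambda>u. slide1 t u v)" "inj (\<lambda>u. slide2 k t u v)" "inj (\<lambda>u. slide3 k t u v)"
    "inj (\<lambda>u. slide4 k t u v)" "inj (\<lambda>u. slide5 t u v)"
  unfolding slide_defs using neck_pos[OF assms, of k] neck_le[of k t]
  by (auto intro!: box_slide_inj)

lemma unlink_continuous: "continuous_on UNIV (unlink k)"
proof -
  have *: "continuous_on S (slide_x slide1)" "continuous_on S (slide_y (slide2 k))"
    "continuous_on S (slide_x (slide3 k))" "continuous_on S (slide_y (slide4 k))"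
    "continuous_on S (slide_y slide5)" for S
    using slide_continuous slide_displacement
    by (auto intro!: continuous_on_subset[OF slide_x_continuous] continuous_on_subset[OF slide_y_continuous])
  show ?thesis unfolding unlink_def by (intro continuous_on_compose *)
qed

lemma unlink_inj: "inj (unlink k)"
  unfolding unlink_def by (intro inj_compose slide_x_inj slide_y_inj slide_inj)

lemma height_unlink: "height (unlink k p) = height p"
  by (simp add: unlink_def)

lemma scaled_level:
  fixes x y t :: real
  assumes "0 < t"
  obtains u v where "(x, y, t) = (t * u, t * v, t)"
  using assms that[of "x / t" "y / t"] by simp

text \<open>In level coordinates the circle lies in a square that the boxes of the first four slides
  miss; the fifth translates this square by \<open>-1/2\<close> in \<open>v\<close>.\<close>

lemma unlink_right_cone:
  assumes "p \<in> circ_cone (1, 1/2)"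
  shows "unlink k p = shear (0, -1/2) p"
proof -
  obtain x y t where p: "p = (x, y, t)" by (cases p)
  show ?thesis
  proof (cases "t > 0")
    case True
    then obtain u v where uv: "p = (t * u, t * v, t)" using p scaled_level by metis
    have "(t * u - t)^2 + (t * v - t / 2)^2 = t^2 / 16"
      using assms by (simp add: uv circ_cone_iff)
    then have "t^2 * ((u - 1)^2 + (v - 1/2)^2) = t^2 * (1/4)^2"
      by (simp add: power2_eq_square algebra_simps)
    then have "(u - 1)^2 + (v - 1/2)^2 = (1/4)^2" using True by simp
    then have "(u - 1)^2 \<le> (1/4)^2" "(v - 1/2)^2 \<le> (1/4)^2"
      using zero_le_power2[of "u - 1"] zero_le_power2[of "v - 1/2"] by linarith+
    then have "\<bar>u - 1\<bar> \<le> 1/4" "\<bar>v - 1/2\<bar> \<le> 1/4" by (simp_all add: abs_le_square_iff[symmetric] )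
    then have b: "0.75 \<le> u" "u \<le> 1.25" "0.25 \<le> v" "v \<le> 0.75" by (simp; linarith)+
    note n = neck_pos[OF True, of k] neck_le[of k t]
    have 1: "slide1 t u v = u" unfolding slide1_def by (rule box_slide_outside) (use b in auto)
    have 2: "slide2 k t v u = v" unfolding slide2_def by (rule box_slide_outside) (use b in auto)
    have 3: "slide3 k t u v = u" unfolding slide3_def by (rule box_slide_outside) (use b n in auto)
    have 4: "slide4 k t v u = v" unfolding slide4_def by (rule box_slide_outside) (use b n in auto)
    have 5: "slide5 t v u = v - 1/2"
      unfolding slide5_def by (subst box_slide_core) (use b in auto)
    show ?thesis
      unfolding uv unlink_def by (simp add: slide_level[OF True] 1 2 3 4 5 shear_def algebra_simps)
  next
    case False
    then show ?thesis using assms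
      by (simp add: p unlink_def slide_nonpos circ_cone_def shear_height_zero)
  qed
qed

text \<open>Each of the first four slides is affine where the circle has arrived. The third undoes
  the narrowing of the first up to a translation, the fourth undoes the flattening of the second,
  and the fifth acts only in the other lobe.\<close>

lemma unlink_left_cone:
  assumes "p \<in> circ_cone (1, -1/2)"
  shows "unlink k p = shear (-2, 1/2) p"
proof -
  obtain x y t where p: "p = (x, y, t)" by (cases p)
  show ?thesis
  proof (cases "t > 0")
    case True
    then obtain u v where uv: "p = (t * u, t * v, t)" using p scaled_level by metis
    have "(t * u - t)^2 + (t * v + t / 2)^2 = t^2 / 16"
      using assms by (simp add: uv circ_cone_iff)
    then have "t^2 * ((u - 1)^2 + (v + 1/2)^2) = t^2 * (1/4)^2"
      by (simp add: power2_eq_square algebra_simps)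
    then have "(u - 1)^2 + (v + 1/2)^2 = (1/4)^2" using True by simp
    then have "(u - 1)^2 \<le> (1/4)^2" "(v + 1/2)^2 \<le> (1/4)^2"
      using zero_le_power2[of "u - 1"] zero_le_power2[of "v + 1/2"] by linarith+
    then have "\<bar>u - 1\<bar> \<le> 1/4" "\<bar>v + 1/2\<bar> \<le> 1/4" by (simp_all add: abs_le_square_iff[symmetric] )
    then have b: "0.75 \<le> u" "u \<le> 1.25" "-0.75 \<le> v" "v \<le> -0.25" by (simp; linarith)+
    note n = neck_pos[OF True, of k] neck_le[of k t]
    define u1 where "u1 = 0.45 + (u - 0.75) * 0.4"
    define v1 where "v1 = - neck k t / 2 + (v + 0.75) * (2 * neck k t)"
    have u1: "0.45 \<le> u1" "u1 \<le> 0.65" using b by (auto simp: u1_def)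
    have "(v + 0.75) * (2 * neck k t) \<ge> 0" "(v + 0.75) * (2 * neck k t) \<le> 0.5 * (2 * neck k t)"
      using b n by (auto intro!: mult_right_mono)
    then have v1: "- neck k t / 2 \<le> v1" "v1 \<le> neck k t / 2" unfolding v1_def by linarith+
    have 1: "slide1 t u v = u1"
      unfolding slide1_def u1_def by (subst box_slide_core) (use b in auto)
    have 2: "slide2 k t v u1 = v1"
      unfolding slide2_def v1_def by (subst box_slide_core) (use b u1 in auto)
    have 3: "slide3 k t u1 v1 = u - 2"
      unfolding slide3_def by (subst box_slide_core) (use u1 v1 n in \<open>auto simp: u1_def field_simps\<close>)
    have 4: "slide4 k t v1 (u - 2) = v + 1/2"
      unfolding slide4_def
      by (subst box_slide_core) (use b v1 n in \<open>auto simp: v1_def field_simps\<close>)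
    have 5: "slide5 t (v + 1/2) (u - 2) = v + 1/2"
      unfolding slide5_def by (rule box_slide_outside) (use b in auto)
    have "unlink k p = (t * (u - 2), t * (v + 1/2), t)"
      unfolding uv unlink_def o_apply slide_level[OF True] 1 2 3 4 5 ..
    then show ?thesis by (simp add: uv shear_def algebra_simps)
  next
    case False
    then show ?thesis using assms
      by (simp add: p unlink_def slide_nonpos circ_cone_def shear_height_zero)
  qed
qed

lemma unlink_peanut:
  assumes k: "k > 4" and "p \<in> peanut k" "height p < 1"
  shows "unlink k p = p"
proof -
  obtain x y t where p: "p = (x, y, t)" by (cases p)
  show ?thesis
  proof (cases "t > 0")
    case True
    then obtain u v where uv: "p = (t * u, t * v, t)" using p scaled_level by metis
    note n = neck_pos[OF True, of k] neck_le[of k t]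
    have "(t * u)^2 - 2 * (t * u) * t + (t * v)^2 \<ge> 0" "(t * u)^2 + 2 * (t * u) * t + (t * v)^2 \<ge> 0"
      using peanut_factors_nonneg[OF assms(2)[unfolded uv]] .
    then have "t^2 * ((u - 1)^2 + v^2 - 1) \<ge> 0" "t^2 * ((u + 1)^2 + v^2 - 1) \<ge> 0"
      by (simp_all add: power2_eq_square algebra_simps)
    then have out: "(u - 1)^2 + v^2 \<ge> 1" "(u + 1)^2 + v^2 \<ge> 1"
      using True by (auto simp: zero_le_mult_iff)
    \<comment> \<open>As \<open>0.6^2 + 0.8^2 = 1\<close>, this box lies in an open unit disc, hence
      inside the peanut. It contains the supports of all slides but the third.\<close>
    have box: "u \<le> s - 0.6 \<or> s + 0.6 \<le> u \<or> v \<le> -0.8 \<or> 0.8 \<le> v" if "s = 1 \<or> s = -1" for s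
    proof (rule ccontr)
      assume "\<not> ?thesis"
      then have "\<bar>u - s\<bar> < 0.6" "\<bar>v\<bar> < 0.8" by linarith+
      then have "\<bar>u - s\<bar>^2 < 0.6^2" "\<bar>v\<bar>^2 < 0.8^2" by (intro power_strict_mono; simp)+
      then have "(u - s)^2 + v^2 < 1" by (simp add: power2_eq_square)
      then show False using that out by auto
    qed
    \<comment> \<open>The quartic equals \<open>u^2 * (u^2 + 2 * v^2 - 4) + v^4\<close>; on this
      strip the first summand is at most 0 and \<open>v^4\<close> is below
      \<open>t^(k - 4)\<close>.\<close>
    have thin: "u \<le> -1.5 \<or> 0.7 \<le> u \<or> v \<le> - neck k t \<or> neck k t \<le> v"
    proof (rule ccontr)
      assume "\<not> ?thesis"
      then have uv': "\<bar>u\<bar> \<le> 1.5" "\<bar>v\<bar> < neck k t" by auto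
      then have "\<bar>u\<bar> \<le> 1.5" "\<bar>v\<bar> \<le> 0.1" using n by auto
      then have "\<bar>u\<bar>^2 \<le> 1.5^2" "\<bar>v\<bar>^2 \<le> 0.1^2" by (intro power_mono; simp)+
      then have "u^2 * (u^2 + 2 * v^2 - 4) \<le> 0"
        by (intro mult_nonneg_nonpos) (auto simp: power2_eq_square)
      moreover have "\<bar>v\<bar>^4 < neck k t ^ 4" using uv' by (intro power_strict_mono) auto
      then have "v^4 < t^(k - 4)"
        using neck_power4_le[OF True, of k] assms(3) by (simp add: uv)
      ultimately have "(u^2 - 2*u + v^2) * (u^2 + 2*u + v^2) < t^(k - 4)"
        by (simp add: algebra_simps power2_eq_square power4_eq_xxxx)
      then have "t^4 * ((u^2 - 2*u + v^2) * (u^2 + 2*u + v^2)) < t^4 * t^(k - 4)"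
        using True by (intro mult_strict_left_mono) auto
      also have "t^4 * t^(k - 4) = t^k" using k by (simp flip: power_add)
      also have "t^4 * ((u^2 - 2*u + v^2) * (u^2 + 2*u + v^2)) = t^k"
        using assms(2) by (simp add: uv peanut_def peanut_fun_def algebra_simps power2_eq_square power4_eq_xxxx)
      finally show False by simp
    qed
    have 1: "slide1 t u v = u"
      unfolding slide1_def by (rule box_slide_outside) (use box[of 1] in auto)
    have 2: "slide2 k t v u = v"
      unfolding slide2_def by (rule box_slide_outside) (use box[of 1] in auto)
    have 3: "slide3 k t u v = u"
      unfolding slide3_def by (rule box_slide_outside) (use thin n in auto)
    have 4: "slide4 k t v u = v"
      unfolding slide4_def by (rule box_slide_outside) (use box[of "-1"] n in auto)
    have 5: "slide5 t v u = v"
      unfolding slide5_def by (rule box_slide_outside) (use box[of 1] in auto)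
    show ?thesis
      unfolding uv unlink_def by (simp add: slide_level[OF True] 1 2 3 4 5)
  next
    case False
    then show ?thesis by (simp add: p unlink_def slide_nonpos)
  qed
qed

proposition ambient_topo_equiv_X1_X2:
  assumes "k > 4"
  shows "ambient_topo_equiv (X1 k) (X2 k)"
  unfolding X1_eq X2_eq
  by (rule ambient_topo_equiv_three_cones[OF assms unlink_continuous[of k] unlink_inj])
    (simp_all add: height_unlink unlink_peanut[OF assms] unlink_right_cone unlink_left_cone)

section \<open>Ambient bi-Lipschitz inequivalence\<close>

lemma continuous_on_height [continuous_intros]: "continuous_on S height"
  unfolding height_def by (intro continuous_intros)

lemma continuous_on_offset [continuous_intros]: "continuous_on S (offset c)"
  unfolding offset_def by (intro continuous_intros)

lemma continuous_on_peanut_fun [continuous_intros]: "continuous_on S (peanut_fun k)"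
  unfolding peanut_fun_def case_prod_unfold by (intro continuous_intros)

lemma closed_circ_cone: "closed (circ_cone c)"
  unfolding circ_cone_def
  by (intro closed_Collect_conj closed_Collect_le closed_Collect_eq continuous_intros)
    (auto intro: continuous_intros)

lemma closed_peanut: "closed (peanut k)"
  unfolding peanut_def
  by (intro closed_Collect_conj closed_Collect_le closed_Collect_eq continuous_intros)

text \<open>Parametrized by height and angle. Height 0 is left out because only there do the pieces
  touch.\<close>

lemma connected_circ_cone_part:
  "connected (circ_cone c \<inter> {p. 0 < height p \<and> height p < \<delta>})"
proof -
  obtain a b where c: "c = (a, b)" by (cases c)
  define f :: "real \<times> real \<Rightarrow> real \<times> real \<times> real"
    where "f = (\<lambda>(t, \<theta>). (t * a + t / 4 * cos \<theta>, t * b + t / 4 * sin \<theta>, t))"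
  have "connected (f ` ({0<..<\<delta>} \<times> UNIV))"
    unfolding f_def case_prod_unfold
    by (intro connected_continuous_image continuous_intros connected_Times) auto
  moreover have "f ` ({0<..<\<delta>} \<times> UNIV) = circ_cone c \<inter> {p. 0 < height p \<and> height p < \<delta>}"
  proof (intro equalityI subsetI)
    fix p assume "p \<in> f ` ({0<..<\<delta>} \<times> UNIV)"
    then obtain t \<theta> where p: "p = f (t, \<theta>)" "0 < t" "t < \<delta>" by auto
    have "(t / 4 * cos \<theta>)^2 + (t / 4 * sin \<theta>)^2 = (t / 4)^2 * ((cos \<theta>)^2 + (sin \<theta>)^2)"
      by (simp only: power_mult_distrib distrib_left)
    then show "p \<in> circ_cone c \<inter> {p. 0 < height p \<and> height p < \<delta>}"
      using p by (simp add: f_def c circ_cone_iff power_divide)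
  next
    fix p assume p: "p \<in> circ_cone c \<inter> {p. 0 < height p \<and> height p < \<delta>}"
    obtain x y t where xyt: "p = (x, y, t)" by (cases p)
    have t: "0 < t" "t < \<delta>" and eq: "(x - t * a)^2 + (y - t * b)^2 = t^2 / 16"
      using p by (auto simp: xyt c circ_cone_iff)
    have "((x - t * a) * 4 / t)^2 + ((y - t * b) * 4 / t)^2 = ((x - t * a)^2 + (y - t * b)^2) * 16 / t^2"
      by (simp only: power_divide power_mult_distrib add_divide_distrib distrib_right) simp
    also have "\<dots> = 1" using t by (simp add: eq)
    finally obtain \<theta> where "(x - t * a) * 4 / t = cos \<theta>" "(y - t * b) * 4 / t = sin \<theta>"
      by (rule sincos_total_2pi)
    then have "p = f (t, \<theta>)" using t by (simp add: xyt f_def field_simps)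
    then show "p \<in> f ` ({0<..<\<delta>} \<times> UNIV)" using t by auto
  qed
  ultimately show ?thesis by simp
qed

lemma polar_nonneg:
  fixes x y :: real
  obtains r \<theta> where "0 \<le> r" "x = r * cos \<theta>" "y = r * sin \<theta>"
proof -
  obtain r \<theta> where *: "x = r * cos \<theta>" "y = r * sin \<theta>" using polar_Ex by blast
  show thesis
  proof (cases "0 \<le> r")
    case True
    then show ?thesis using that * by blast
  next
    case False
    then show ?thesis using that[of "- r" "\<theta> + pi"] * by simp
  qed
qed

text \<open>The equation is quadratic in \<open>r^2\<close>; completing the square prepares for
  solving it on each ray.\<close>

lemma peanut_fun_polar:
  "peanut_fun k (r * cos \<theta>, r * sin \<theta>, t)
    = (r^2 - 2 * t^2 * (cos \<theta>)^2)^2 - (4 * t^4 * (cos \<theta>)^4 + t^k)"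
proof -
  have r: "(r * cos \<theta>)^2 + (r * sin \<theta>)^2 = r^2"
    by (simp only: power_mult_distrib distrib_left[symmetric]) simp
  have "peanut_fun k (r * cos \<theta>, r * sin \<theta>, t)
      = ((r * cos \<theta>)^2 + (r * sin \<theta>)^2)^2 - (2 * (r * cos \<theta>) * t)^2 - t^k"
    by (simp add: peanut_fun_def power2_eq_square algebra_simps)
  then show ?thesis unfolding r by (simp add: power2_eq_square power4_eq_xxxx algebra_simps)
qed

text \<open>At positive height every ray from the axis meets the peanut exactly once, so height and
  angle parametrize it continuously.\<close>

lemma connected_peanut_part:
  "connected (peanut k \<inter> {p. 0 < height p \<and> height p < \<delta>})"
proof -
  define S where "S = (\<lambda>t \<theta>. 2 * t^2 * (cos \<theta>)^2 + sqrt (4 * t^4 * (cos \<theta>)^4 + t^k))"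
  define f :: "real \<times> real \<Rightarrow> real \<times> real \<times> real"
    where "f = (\<lambda>(t, \<theta>). (sqrt (S t \<theta>) * cos \<theta>, sqrt (S t \<theta>) * sin \<theta>, t))"
  have "connected (f ` ({0<..<\<delta>} \<times> UNIV))"
    unfolding f_def S_def case_prod_unfold
    by (intro connected_continuous_image continuous_intros connected_Times) auto
  moreover have "f ` ({0<..<\<delta>} \<times> UNIV) = peanut k \<inter> {p. 0 < height p \<and> height p < \<delta>}"
  proof (intro equalityI subsetI)
    fix p assume "p \<in> f ` ({0<..<\<delta>} \<times> UNIV)"
    then obtain t \<theta> where p: "p = f (t, \<theta>)" "0 < t" "t < \<delta>" by auto
    have "S t \<theta> \<ge> 0" using p by (simp add: S_def)
    then have "peanut_fun k p = (S t \<theta> - 2 * t^2 * (cos \<theta>)^2)^2 - (4 * t^4 * (cos \<theta>)^4 + t^k)"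
      by (simp add: p f_def peanut_fun_polar)
    also have "\<dots> = 0" using p by (simp add: S_def)
    finally show "p \<in> peanut k \<inter> {p. 0 < height p \<and> height p < \<delta>}"
      using p by (simp add: peanut_def f_def)
  next
    fix p assume p: "p \<in> peanut k \<inter> {p. 0 < height p \<and> height p < \<delta>}"
    obtain x y t where xyt: "p = (x, y, t)" by (cases p)
    obtain r \<theta> where r: "0 \<le> r" "x = r * cos \<theta>" "y = r * sin \<theta>" by (rule polar_nonneg)
    have t: "0 < t" "t < \<delta>" using p by (auto simp: xyt)
    let ?C = "2 * t^2 * (cos \<theta>)^2"
    have eq: "(r^2 - ?C)^2 = 4 * t^4 * (cos \<theta>)^4 + t^k"
      using p peanut_fun_polar[of k r \<theta> t] by (simp add: xyt r peanut_def)
    \<comment> \<open>Strict because \<open>t^k\<close> is positive; this rules out the smaller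
      root, which would make \<open>r^2\<close> negative.\<close>
    then have "(r^2 - ?C)^2 > ?C^2" using t by (simp add: power_mult_distrib)
    then have gt: "\<bar>r^2 - ?C\<bar> > ?C" by (simp add: power2_less_imp_less)
    then have "r^2 - ?C \<ge> 0" using zero_le_power2[of r] by linarith
    then have "r^2 - ?C = sqrt (4 * t^4 * (cos \<theta>)^4 + t^k)"
      unfolding eq[symmetric] by simp
    then have "r^2 = S t \<theta>" by (simp add: S_def)
    then have "r = sqrt (S t \<theta>)" using r(1) by (metis real_sqrt_abs abs_of_nonneg)
    then have "p = f (t, \<theta>)" by (simp add: xyt f_def r)
    then show "p \<in> f ` ({0<..<\<delta>} \<times> UNIV)" using t by auto
  qed
  ultimately show ?thesis by simp
qed

text \<open>A circular cone is normally embedded: the chord between two nearby points is projected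
radially onto the cone.\<close>

lemma circ_cone_chord:
  assumes p: "p \<in> circ_cone c" and q: "q \<in> circ_cone c" and c: "norm c \<le> 2"
    and d: "0 < height p" "40 * dist p q \<le> height p"
  obtains S where "connected S" "p \<in> S" "q \<in> S" "S \<subseteq> circ_cone c"
    "\<And>z. z \<in> S \<Longrightarrow> dist p z \<le> 5 * dist p q"
proof -
  \<comment> \<open>\<open>e z\<close> is the radial correction that brings the norm of the offset
    to a quarter of the height; \<open>\<pi>\<close> applies it without changing the height.\<close>
  define e where "e = (\<lambda>z. (height z / 4 / norm (offset c z) - 1) *\<^sub>R offset c z)"
  define \<pi> where "\<pi> = (\<lambda>z :: real \<times> real \<times> real. z + (fst (e z), snd (e z), 0))"
  let ?I = "closed_segment p q" and ?D = "dist p q"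
  have near: "dist p z \<le> ?D" if "z \<in> ?I" for z
    using segment_bound(1)[OF that] by (simp add: dist_norm norm_minus_commute)
  have lip: "norm (offset c z - offset c p) \<le> 3 * ?D" "\<bar>height z - height p\<bar> \<le> ?D" if "z \<in> ?I" for z
  proof -
    have "norm (offset c z - offset c p) \<le> (1 + norm c) * dist z p" by (rule norm_offset_dist_le)
    also have "\<dots> \<le> 3 * ?D" using c near[OF that] by (intro mult_mono) (auto simp: dist_commute)
    finally show "norm (offset c z - offset c p) \<le> 3 * ?D" .
    show "\<bar>height z - height p\<bar> \<le> ?D"
      using height_dist_le[of z p] near[OF that] by (simp add: dist_commute)
  qed
  have np: "norm (offset c p) = height p / 4" using p by (simp add: circ_cone_def)
  have diff: "\<bar>norm (offset c z) - height p / 4\<bar> \<le> 3 * ?D" if "z \<in> ?I" for z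
    using norm_triangle_ineq3[of "offset c z" "offset c p"] lip(1)[OF that] np by linarith
  \<comment> \<open>The factor 40 in the hypothesis keeps the chord away from the axis, so the
    radial projection is defined on it.\<close>
  have pos: "0 < norm (offset c z)" "0 < height z" if "z \<in> ?I" for z
    using diff[OF that] lip(2)[OF that] d by linarith+
  have ne: "norm (e z) \<le> 4 * ?D" if "z \<in> ?I" for z
  proof -
    have "norm (e z) = \<bar>(height z / 4 / norm (offset c z) - 1) * norm (offset c z)\<bar>"
      by (simp add: e_def abs_mult)
    also have "\<dots> = \<bar>height z / 4 - norm (offset c z)\<bar>"
      using pos[OF that] by (simp add: algebra_simps)
    also have "\<dots> \<le> 4 * ?D" using diff[OF that] lip(2)[OF that] by linarith
    finally show ?thesis .
  qed
  have h\<pi>: "height (\<pi> z) = height z" for z by (simp add: \<pi>_def height_def)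
  have "offset c (\<pi> z) = offset c z + e z" for z
    by (simp add: offset_def \<pi>_def height_def prod_eq_iff)
  then have o\<pi>: "offset c (\<pi> z) = (height z / 4 / norm (offset c z)) *\<^sub>R offset c z" for z
    by (simp add: e_def algebra_simps)
  have in_cone: "\<pi> z \<in> circ_cone c" if "z \<in> ?I" for z
    using pos[OF that] by (simp add: circ_cone_def h\<pi> o\<pi>)
  have fix_cone: "\<pi> z = z" if "z \<in> circ_cone c" "z \<in> ?I" for z
  proof -
    have "e z = 0" using that(1) pos[OF that(2)] by (simp add: e_def circ_cone_def)
    then show ?thesis by (simp add: \<pi>_def zero_prod_def)
  qed
  have "continuous_on ?I \<pi>"
    unfolding \<pi>_def e_def using pos by (intro continuous_intros) auto
  then have "connected (\<pi> ` ?I)" by (intro connected_continuous_image connected_segment)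
  moreover have "p \<in> \<pi> ` ?I" "q \<in> \<pi> ` ?I" using fix_cone p q by (metis ends_in_segment image_eqI)+
  moreover have "dist p (\<pi> z) \<le> 5 * ?D" if "z \<in> ?I" for z
  proof -
    have "dist z (\<pi> z) = norm (e z)"
      by (cases "e z") (simp add: \<pi>_def dist_norm norm_Pair)
    then show ?thesis using near[OF that] ne[OF that] dist_triangle[of p "\<pi> z" z] by simp
  qed
  ultimately show thesis using that[of "\<pi> ` ?I"] in_cone by blast
qed

lemma three_cones_height_pos:
  assumes "k > 4" "admissible k c c'" "p \<in> three_cones k c c'" "p \<noteq> 0"
  shows "0 < height p"
proof -
  have "height p \<ge> 0" using assms(3) by (auto simp: three_cones_def peanut_def circ_cone_def)
  moreover have "height p \<noteq> 0"
    using norm_three_cones_le[OF assms(1-3)] assms(4) by auto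
  ultimately show ?thesis by simp
qed

text \<open>Off the origin the three closed pieces are disjoint; connectedness is applied to each
  cone against the union of the other two pieces.\<close>

lemma connected_subset_three_cones:
  assumes k: "k > 4" and adm: "admissible k c c'"
    and S: "connected S" "S \<subseteq> three_cones k c c'" "0 \<notin> S"
  shows "S \<subseteq> peanut k \<or> S \<subseteq> circ_cone c \<or> S \<subseteq> circ_cone c'"
proof -
  have pos: "height p > 0" if "p \<in> S" for p
    using three_cones_height_pos[OF k adm] that S by blast
  have d1: "z \<notin> peanut k \<union> circ_cone c'" if "z \<in> S" "z \<in> circ_cone c" for z
    using three_cones_disjoint[OF adm that(2)] pos[OF that(1)] by auto
  have d2: "z \<notin> peanut k \<union> circ_cone c" if "z \<in> S" "z \<in> circ_cone c'" for z
    using three_cones_disjoint[OF admissible_sym[OF adm] that(2)] pos[OF that(1)] by auto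
  have dich: "A \<inter> S = {} \<or> B \<inter> S = {}"
    if "closed A" "closed B" "S \<subseteq> A \<union> B" "A \<inter> B \<inter> S = {}" for A B
    using S(1) that unfolding connected_closed by blast
  have "circ_cone c \<inter> S = {} \<or> (peanut k \<union> circ_cone c') \<inter> S = {}"
  proof (rule dich)
    show "circ_cone c \<inter> (peanut k \<union> circ_cone c') \<inter> S = {}"
      using d1 by blast
    show "S \<subseteq> circ_cone c \<union> (peanut k \<union> circ_cone c')" using S(2) by (auto simp: three_cones_def)
  qed (intro closed_Un closed_peanut closed_circ_cone)+
  moreover have "circ_cone c' \<inter> S = {} \<or> (peanut k \<union> circ_cone c) \<inter> S = {}"
  proof (rule dich)
    show "circ_cone c' \<inter> (peanut k \<union> circ_cone c) \<inter> S = {}"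
      using d2 by blast
    show "S \<subseteq> circ_cone c' \<union> (peanut k \<union> circ_cone c)" using S(2) by (auto simp: three_cones_def)
  qed (intro closed_Un closed_peanut closed_circ_cone)+
  ultimately show ?thesis using S(2) unfolding three_cones_def by blast
qed

section \<open>The neck and the interior of the peanut\<close>

lemma X1_axis_far:
  assumes "(x, 0, t) \<in> X1 k" "0 < t"
  shows "2 * t < \<bar>x\<bar>"
proof -
  \<comment> \<open>The plane \<open>y = 0\<close> has distance \<open>t / 2\<close> from the axes
    of both cones, more than their radius \<open>t / 4\<close>.\<close>
  have "(x, 0, t) \<notin> circ_cone (1, s)" if "s^2 = 1/4" for s
  proof
    assume "(x, 0, t) \<in> circ_cone (1, s)"
    then have "(x - t)^2 + t^2 * s^2 = t^2 / 16" by (simp add: circ_cone_iff power_mult_distrib)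
    then have "(x - t)^2 + t^2 / 4 = t^2 / 16" using that by simp
    moreover have "0 < t^2" using assms(2) by simp
    ultimately show False using zero_le_power2[of "x - t"] by linarith
  qed
  then have "(x, 0, t) \<in> peanut k"
    using assms(1) by (auto simp: X1_eq three_cones_def power_divide)
  then have "x^2 * (x^2 - (2 * t)^2) = t^k"
    by (simp add: peanut_def peanut_fun_def power2_eq_square algebra_simps)
  then have "x^2 * (x^2 - (2 * t)^2) > 0" using assms(2) by simp
  then have "(2 * t)^2 < \<bar>x\<bar>^2" by (simp add: zero_less_mult_iff)
  then show ?thesis by (rule power2_less_imp_less) simp
qed

text \<open>The fourth root of \<open>t^k\<close> works: \<open>k > 4\<close> gives
  \<open>t^k \<le> t^5 = t * t^4\<close>, so the half-width of the neck is
  \<open>o(t)\<close>.\<close>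

lemma neck_point_exists:
  fixes t :: real
  assumes "k > 4" "0 < t" "t \<le> 1" "0 < \<eta>" "t \<le> \<eta>^4"
  obtains s where "0 < s" "s \<le> \<eta> * t" "s^4 = t^k"
proof
  let ?s = "root 4 (t^k)"
  show "0 < ?s" "?s^4 = t^k" using assms by auto
  have "t^k \<le> t^5" using assms by (intro power_decreasing) auto
  also have "\<dots> = t * t^4" by (simp add: eval_nat_numeral)
  also have "\<dots> \<le> \<eta>^4 * t^4" using assms by (intro mult_right_mono) auto
  finally have "?s^4 \<le> (\<eta> * t)^4" using assms by (simp add: power_mult_distrib)
  then show "?s \<le> \<eta> * t" using assms by (intro power_le_imp_le_base[of ?s 3]) (auto simp: eval_nat_numeral)
qed

lemma neck_point_in_peanut: "\<lbrakk>s^4 = t^k; 0 \<le> t\<rbrakk> \<Longrightarrow> (0, s, t) \<in> peanut k"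
  by (simp add: peanut_def peanut_fun_def power2_eq_square power4_eq_xxxx)

text \<open>Such a cone lies in the open disc of one lobe, where one quadratic factor is negative
  and the other positive.\<close>

lemma circ_cone_inside:
  assumes "p \<in> circ_cone (e, 0)" "e = 1 \<or> e = -1" "0 < height p"
  shows "0 < e * fst p" "peanut_fun k p < 0"
proof -
  obtain x y t where p: "p = (x, y, t)" by (cases p)
  have t: "0 < t" and eq: "(x - t * e)^2 + y^2 = (t/4)^2"
    using assms by (auto simp: p circ_cone_iff power_divide)
  then have "(x - t * e)^2 \<le> (t/4)^2" using zero_le_power2[of y] by linarith
  then have "\<bar>x - t * e\<bar> \<le> t/4" using t by (simp add: abs_le_square_iff[symmetric])
  then have "x - t * e \<le> t/4" "t * e - x \<le> t/4" unfolding abs_le_iff by linarith+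
  then have x: "e * x \<ge> 3/4 * t" using assms(2) by auto
  then show "0 < e * fst p" using t by (simp add: p)
  define A B where "A = x^2 - 2 * (e * x) * t + y^2" and "B = x^2 + 2 * (e * x) * t + y^2"
  have "A = (x - t * e)^2 + y^2 - t^2" using assms(2) by (auto simp: A_def power2_eq_square algebra_simps)
  then have "A < 0" using eq t by (simp add: power_divide)
  moreover have "B > 0" using x t unfolding B_def
    by (intro add_pos_nonneg add_nonneg_pos) auto
  ultimately have "A * B < 0" by (rule mult_neg_pos)
  moreover have "A * B = (x^2 - 2*x*t + y^2) * (x^2 + 2*x*t + y^2)"
    using assms(2) by (auto simp: A_def B_def)
  ultimately show "peanut_fun k p < 0" using zero_less_power[OF t, of k] by (simp add: p peanut_fun_def)
qed

text \<open>The interior of the peanut and the set \<open>?B\<close> are disjoint open sets covering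
  its complement. At height 0 the function is the square of \<open>x^2 + y^2\<close>, so the
  interior cannot be left there.\<close>

lemma connected_inside_peanut:
  assumes k: "k > 4" and S: "connected S" "S \<inter> peanut k = {}"
    and p: "p \<in> S" "0 < height p" "peanut_fun k p < 0" and q: "q \<in> S"
  shows "0 < height q" "peanut_fun k q < 0"
proof -
  let ?A = "{p. 0 < height p \<and> peanut_fun k p < 0}"
  let ?B = "{p. height p < 0 \<or> 0 < peanut_fun k p}"
  have "open ?A" "open ?B"
    by (intro open_Collect_conj open_Collect_disj open_Collect_less continuous_intros)+
  moreover have "S \<subseteq> ?A \<union> ?B"
  proof
    fix z assume z: "z \<in> S"
    obtain x y t where xyt: "z = (x, y, t)" by (cases z)
    show "z \<in> ?A \<union> ?B"
    proof (rule ccontr)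
      assume *: "z \<notin> ?A \<union> ?B"
      then have "0 \<le> t" "peanut_fun k z \<le> 0" "t = 0 \<or> peanut_fun k z = 0" by (auto simp: xyt)
      moreover have "0 \<le> peanut_fun k z" if "t = 0" using that k by (simp add: xyt peanut_fun_def zero_power)
      ultimately have "z \<in> peanut k" by (auto simp: peanut_def xyt)
      then show False using z S(2) by auto
    qed
  qed
  moreover have "?A \<inter> ?B \<inter> S = {}" by auto
  ultimately have "?B \<inter> S = {}" using connectedD[OF S(1), of ?A ?B] p by blast
  then show "0 < height q" "peanut_fun k q < 0" using q \<open>S \<subseteq> ?A \<union> ?B\<close> by blast+
qed

section \<open>Consequences of a hypothetical ambient bi-Lipschitz equivalence\<close>

locale ambient_bilipschitz =
  fixes k :: nat and U V :: "(real \<times> real \<times> real) set" and h g and L R :: real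
  assumes k: "k > 4" and homeo: "homeomorphism U V h g" and h0: "h 0 = 0"
    and X: "h ` (X1 k \<inter> U) = X2 k \<inter> V"
    and L: "1 \<le> L" and lip: "\<And>p q. p \<in> U \<Longrightarrow> q \<in> U \<Longrightarrow> dist p q \<le> L * dist (h p) (h q)"
      "\<And>p q. p \<in> U \<Longrightarrow> q \<in> U \<Longrightarrow> dist (h p) (h q) \<le> L * dist p q"
    and R: "0 < R" "R \<le> 1" "ball 0 R \<subseteq> U" "ball 0 R \<subseteq> V"
begin

lemma in_U: "norm p < R \<Longrightarrow> p \<in> U" and in_V: "norm p < R \<Longrightarrow> p \<in> V"
  using R by auto

lemma gh: "p \<in> U \<Longrightarrow> g (h p) = p" and hg: "p \<in> V \<Longrightarrow> h (g p) = p"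
  and h_in: "p \<in> U \<Longrightarrow> h p \<in> V" and g_in: "p \<in> V \<Longrightarrow> g p \<in> U"
  using homeo by (auto simp: homeomorphism_def)

lemma h_X_iff:
  assumes "p \<in> U"
  shows "h p \<in> X2 k \<longleftrightarrow> p \<in> X1 k"
proof
  assume "h p \<in> X2 k"
  then have "h p \<in> h ` (X1 k \<inter> U)" unfolding X using h_in[OF assms] by simp
  then obtain q where q: "h p = h q" "q \<in> X1 k \<inter> U" by (rule imageE)
  have "p = g (h q)" using gh[OF assms] unfolding q(1) by (rule sym)
  also have "\<dots> = q" using q(2) by (intro gh) simp
  finally show "p \<in> X1 k" using q(2) by simp
next
  assume "p \<in> X1 k"
  then have "h p \<in> h ` (X1 k \<inter> U)" using assms by simp
  then show "h p \<in> X2 k" unfolding X by simp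
qed

lemma g_X: "p \<in> V \<Longrightarrow> p \<in> X2 k \<Longrightarrow> g p \<in> X1 k"
  using h_X_iff[of "g p"] by (simp add: g_in hg)

lemma zero_U: "0 \<in> U" and g0: "g 0 = 0"
  using in_U[of 0] in_V[of 0] R(1) gh[of 0] h0 by auto

lemma norm_h: "p \<in> U \<Longrightarrow> norm (h p) \<le> L * norm p" "p \<in> U \<Longrightarrow> norm p \<le> L * norm (h p)"
  using lip[of p 0] zero_U h0 by auto

lemma norm_g: "p \<in> V \<Longrightarrow> norm (g p) \<le> L * norm p"
  using norm_h(2)[of "g p"] by (simp add: g_in hg)

lemma h_nonzero: "p \<in> U \<Longrightarrow> p \<noteq> 0 \<Longrightarrow> h p \<noteq> 0"
  using gh g0 by metis

lemma g_nonzero: "p \<in> V \<Longrightarrow> p \<noteq> 0 \<Longrightarrow> g p \<noteq> 0"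
  using hg h0 by metis

text \<open>The two points of the neck are much closer to each other than any path joining them
inside the surface is wide, so they cannot land on a normally embedded circular cone.\<close>

lemma neck_not_in_circ_cone:
  assumes t: "0 < t" "3 * L * t < R" and s: "0 < s" "1000 * L^2 * s \<le> t" "s^4 = t^k"
    and adm: "admissible k c c'" "X2 k = three_cones k c c'"
  shows "h (0, s, t) \<notin> circ_cone c"
proof
  let ?a = "(0, s, t) :: real \<times> real \<times> real" and ?b = "(0, - s, t) :: real \<times> real \<times> real"
  assume ca: "h ?a \<in> circ_cone c"
  have c: "norm c \<le> 2" using adm(1) by (simp add: admissible_def)
  have L2: "L \<le> L^2" "1 \<le> L^2" using L by (auto simp: power2_eq_square mult_le_cancel_left1 intro: order_trans)
  have Ls: "s \<le> L * s" "L * s \<le> L^2 * s" using L L2 s(1) by (auto intro: mult_right_mono)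
  have Lt: "t \<le> L * t" using L t(1) by (simp add: mult_le_cancel_right1)
  have na: "norm ?a \<le> 2 * t" "norm ?b \<le> 2 * t" "t \<le> norm ?a"
  proof -
    have "norm ?a \<le> s + t" "norm ?b \<le> s + t"
      using s t by (auto simp: norm_Pair intro: sqrt_sum_squares_le_sum)
    then show "norm ?a \<le> 2 * t" "norm ?b \<le> 2 * t" using Ls s(1,2) t(1) by linarith+
    show "t \<le> norm ?a" using height_le[of ?a] by simp
  qed
  have ab: "?a \<in> U" "?b \<in> U" using na Lt t by (intro in_U; linarith)+
  have "?a \<in> peanut k" "?b \<in> peanut k" using s t by (auto intro!: neck_point_in_peanut)
  then have "h ?a \<in> X2 k" "h ?b \<in> X2 k" using ab h_X_iff by (auto simp: X1_eq three_cones_def)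
  have "dist ?a ?b = 2 * s" using s by (simp add: dist_Pair_Pair dist_real_def real_sqrt_mult)
  then have D: "dist (h ?a) (h ?b) \<le> 2 * (L * s)" using lip(2)[OF ab] by simp
  have ha: "t \<le> 4 * L * height (h ?a)"
  proof -
    have "t \<le> L * norm (h ?a)" using na norm_h(2)[OF ab(1)] by linarith
    also have "\<dots> \<le> L * (4 * height (h ?a))"
      using L norm_circ_cone_le[OF ca c] by (intro mult_left_mono) auto
    finally show ?thesis by simp
  qed
  \<comment> \<open>The constant 80 is 40, from the chord lemma, times the bound
    \<open>2 * (L * s)\<close> on the distance of the images.\<close>
  have key: "\<not> height (h ?a) \<le> 80 * (L * s)"
  proof
    assume "height (h ?a) \<le> 80 * (L * s)"
    then have "4 * L * height (h ?a) \<le> 4 * L * (80 * (L * s))" using L by (intro mult_left_mono) auto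
    then have "t \<le> 320 * (L^2 * s)" using ha by (simp add: power2_eq_square)
    then show False using s t Ls by simp
  qed
  have cb: "h ?b \<in> circ_cone c"
  proof (rule ccontr)
    assume "h ?b \<notin> circ_cone c"
    then have "height (h ?a) \<le> 17 * dist (h ?a) (h ?b)"
      using three_cones_separated(1)[OF adm(1) ca] \<open>h ?b \<in> X2 k\<close> adm(2) by (auto simp: three_cones_def)
    then show False using key D s Ls by linarith
  qed
  have "0 < height (h ?a)" "40 * dist (h ?a) (h ?b) \<le> height (h ?a)"
    using key D s Ls by linarith+
  from circ_cone_chord[OF ca cb c this] obtain S where S: "connected S" "h ?a \<in> S" "h ?b \<in> S"
      "S \<subseteq> circ_cone c" "\<And>z. z \<in> S \<Longrightarrow> dist (h ?a) z \<le> 5 * dist (h ?a) (h ?b)" by blast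
  have SV: "S \<subseteq> V"
  proof
    fix z assume "z \<in> S"
    then have "norm z \<le> norm (h ?a) + 5 * (2 * (L * s))"
      using S(5)[of z] D norm_triangle_ineq2[of z "h ?a"] by (simp add: dist_norm norm_minus_commute)
    also have "norm (h ?a) \<le> L * (2 * t)"
      using norm_h(1)[OF ab(1)] na(1) mult_left_mono[OF na(1), of L] L by linarith
    finally show "z \<in> V" using s Ls Lt t by (intro in_V) linarith
  qed
  \<comment> \<open>Pulled back by \<open>g\<close>, the set \<open>S\<close> joins the two neck
    points and must cross the plane \<open>y = 0\<close>. The surface meets this plane only far from
    the neck, but the pulled-back set stays within \<open>t / 100\<close> of the first neck
    point.\<close>
  have "continuous_on S g" using homeo SV by (auto simp: homeomorphism_def intro: continuous_on_subset)
  then have T: "connected ((\<lambda>z. fst (snd (g z))) ` S)"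
    using S(1) by (intro connected_continuous_image continuous_intros)
  have "s \<in> (\<lambda>z. fst (snd (g z))) ` S" "- s \<in> (\<lambda>z. fst (snd (g z))) ` S"
    using S(2,3) gh ab by (auto simp: image_iff intro: bexI[of _ "h ?a"] bexI[of _ "h ?b"])
  then have "0 \<in> (\<lambda>z. fst (snd (g z))) ` S"
    using connectedD_interval[OF T, of "- s" s 0] s by auto
  then obtain z where z: "z \<in> S" "fst (snd (g z)) = 0" by auto
  obtain x w where gz: "g z = (x, 0, w)" using z(2) by (metis prod.collapse)
  have zV: "z \<in> V" using z SV by auto
  have "dist ?a (g z) \<le> L * dist (h ?a) z" using lip(1)[OF ab(1) g_in[OF zV]] by (simp add: hg zV)
  also have "\<dots> \<le> L * (5 * (2 * (L * s)))" using S(5)[OF z(1)] D L by (intro mult_left_mono) auto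
  finally have dz: "dist ?a (g z) \<le> t / 100" using s by (simp add: power2_eq_square)
  have "\<bar>x\<bar> \<le> dist ?a (g z)" using dist_fst_le[of ?a "g z"] by (simp add: gz dist_real_def)
  moreover have "\<bar>t - w\<bar> \<le> dist ?a (g z)" using height_dist_le[of ?a "g z"] by (simp add: gz)
  moreover have "g z \<in> X1 k" using g_X[OF zV] z S(4) adm(2) by (auto simp: three_cones_def)
  ultimately have "\<bar>x\<bar> \<le> t / 100" "\<bar>t - w\<bar> \<le> t / 100" "(x, 0, w) \<in> X1 k"
    using dz by (auto simp: gz)
  moreover from this have "0 < w" using t(1) by linarith
  ultimately show False using X1_axis_far[of x w k] t(1) by linarith
qed

text \<open>On \<open>X1\<close> the norm is at most 4 times a small height, so points below this
  height lie in the ball of radius \<open>R\<close>.\<close>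

definition \<delta> :: real where "\<delta> = R / 4"

lemma X1_small: "\<lbrakk>p \<in> X1 k; height p < \<delta>\<rbrakk> \<Longrightarrow> p \<in> U"
  using norm_three_cones_le[OF k admissible_X1[of k], of p] R by (intro in_U) (simp add: X1_eq \<delta>_def)

text \<open>The image of a connected part avoids the origin, hence lies in one piece of
  \<open>X2\<close>; as the pieces are disjoint there, a single point decides which.\<close>

lemma part_image:
  assumes A: "connected (A \<inter> {p. 0 < height p \<and> height p < \<delta>})" "A \<subseteq> X1 k"
    and p: "p \<in> A" "0 < height p" "height p < \<delta>"
    and B: "h p \<in> B" "B = peanut k \<or> B = circ_cone (1, 0) \<or> B = circ_cone (-1, 0)"
    and q: "q \<in> A" "0 < height q" "height q < \<delta>"
  shows "h q \<in> B"
proof -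
  let ?A = "A \<inter> {p. 0 < height p \<and> height p < \<delta>}"
  have AU: "?A \<subseteq> U" using X1_small A(2) by blast
  have "continuous_on ?A h" using homeo AU by (auto simp: homeomorphism_def intro: continuous_on_subset)
  then have "connected (h ` ?A)" using A(1) by (rule connected_continuous_image)
  moreover have "h ` ?A \<subseteq> X2 k" using A(2) AU h_X_iff by blast
  moreover have "0 \<notin> h ` ?A"
  proof
    assume "0 \<in> h ` ?A"
    then obtain z where "z \<in> ?A" "h z = 0" by force
    moreover from this have "z \<in> U" "z \<noteq> 0" using AU by auto
    ultimately show False using h_nonzero[of z] by simp
  qed
  ultimately have "h ` ?A \<subseteq> peanut k \<or> h ` ?A \<subseteq> circ_cone (1, 0) \<or> h ` ?A \<subseteq> circ_cone (-1, 0)"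
    using connected_subset_three_cones[OF k admissible_X2] by (simp add: X2_eq)
  then obtain B' where B': "h ` ?A \<subseteq> B'" "B' = peanut k \<or> B' = circ_cone (1, 0) \<or> B' = circ_cone (-1, 0)"
    by blast
  have "h p \<in> B'" using B'(1) p by auto
  have "p \<in> U" "p \<noteq> 0" using AU p by auto
  then have "h p \<in> three_cones k (1, 0) (-1, 0)" "h p \<noteq> 0"
    using h_X_iff[of p] h_nonzero[of p] A(2) p(1) by (auto simp: X2_eq)
  then have "0 < height (h p)" by (rule three_cones_height_pos[OF k admissible_X2])
  then have "B' = B"
    using \<open>h p \<in> B'\<close> B B'(2) three_cones_disjoint[OF admissible_X2, of "h p" k]
      three_cones_disjoint[OF admissible_sym[OF admissible_X2], of "h p" k] by auto
  then show ?thesis using B'(1) q by auto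
qed

lemma X2_sym: "X2 k = three_cones k (-1, 0) (1, 0)"
  by (auto simp: X2_eq three_cones_def)

text \<open>Chosen so that \<open>s \<le> \<eta> * t\<close> yields the hypothesis
  \<open>1000 * L^2 * s \<le> t\<close> of \<open>neck_not_in_circ_cone\<close>.\<close>

definition \<eta> :: real where "\<eta> = 1 / (1000 * L^2)"

lemma \<eta>: "0 < \<eta>" and \<eta>_L: "1000 * L^2 * \<eta> = 1"
  using L by (auto simp: \<eta>_def)

lemma L_le_sq: "L \<le> L^2"
  using L by (simp add: power2_eq_square mult_le_cancel_left1)

lemma circ_cone_peanut_disjoint:
  assumes "p \<in> circ_cone (e, 0)" "e = 1 \<or> e = -1" "p \<noteq> 0"
  shows "p \<notin> peanut k" "p \<notin> circ_cone (- e, 0)"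
proof -
  have "p \<in> three_cones k (1, 0) (-1, 0)" using assms by (auto simp: three_cones_def)
  then have "0 < height p" using assms(3) by (rule three_cones_height_pos[OF k admissible_X2])
  then show "p \<notin> peanut k" "p \<notin> circ_cone (- e, 0)"
    using assms three_cones_disjoint[OF admissible_X2, of p k]
      three_cones_disjoint[OF admissible_sym[OF admissible_X2], of p k] by auto
qed

text \<open>One neck point at a small height cannot land on either cone, so it lands on the peanut;
  connectedness carries this to all points of small positive height.\<close>

lemma h_peanut:
  assumes "p \<in> peanut k" "0 < height p" "height p < \<delta>"
  shows "h p \<in> peanut k"
proof -
  define t where "t = min (\<eta>^4) (R / (5 * L))"
  have t: "0 < t" "t \<le> \<eta>^4" "t \<le> R / (5 * L)" using \<eta> R L by (auto simp: t_def)
  have tL: "5 * (L * t) \<le> R" using t(3) L by (simp add: field_simps)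
  have "t \<le> L * t" using L t(1) by (simp add: mult_le_cancel_right1)
  then have t': "t \<le> 1" "3 * L * t < R" "t < \<delta>" using tL t(1) R unfolding \<delta>_def by linarith+
  obtain s where s: "0 < s" "s \<le> \<eta> * t" "s^4 = t^k"
    using neck_point_exists[OF k t(1) t'(1) \<eta> t(2)] .
  have "1000 * L^2 * s \<le> 1000 * L^2 * (\<eta> * t)" using s(2) by (intro mult_left_mono) auto
  also have "\<dots> = t" using \<eta>_L by (simp flip: mult.assoc)
  finally have s': "1000 * L^2 * s \<le> t" .
  note nc = neck_not_in_circ_cone[OF t(1) t'(2) s(1) s' s(3)]
  have "h (0, s, t) \<notin> circ_cone (1, 0)" "h (0, s, t) \<notin> circ_cone (-1, 0)"
    by (rule nc[OF admissible_X2 X2_eq], rule nc[OF admissible_sym[OF admissible_X2] X2_sym])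
  moreover have pt: "(0, s, t) \<in> peanut k" using s t by (intro neck_point_in_peanut) auto
  then have "(0, s, t) \<in> X1 k" by (simp add: X1_eq three_cones_def)
  then have "h (0, s, t) \<in> X2 k" using X1_small[of "(0, s, t)"] h_X_iff t' by auto
  ultimately have "h (0, s, t) \<in> peanut k" by (simp add: X2_eq three_cones_def)
  then show ?thesis
    using part_image[OF connected_peanut_part _ pt, of "peanut k" p] assms t t'
    by (auto simp: X1_eq three_cones_def)
qed

lemma g_small:
  assumes "p \<in> X2 k" "p \<noteq> 0" "norm p < R" "L * norm p < \<delta>"
  shows "p \<in> V" "g p \<in> X1 k" "0 < height (g p)" "height (g p) < \<delta>"
proof -
  show V: "p \<in> V" using assms(3) by (rule in_V)
  then show X1: "g p \<in> X1 k" using assms(1) by (rule g_X)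
  show "0 < height (g p)"
    using three_cones_height_pos[OF k admissible_X1[of k]] X1 g_nonzero[OF V assms(2)] by (simp add: X1_eq)
  show "height (g p) < \<delta>"
    using height_le[of "g p"] norm_g[OF V] assms(4) by linarith
qed

text \<open>A point of the target cone is pulled back. It cannot come from the peanut, which goes to
  the peanut, so it comes from some cone, and connectedness determines the image of that
  cone.\<close>

lemma circ_cone_image:
  assumes e: "e = 1 \<or> e = -1"
  obtains \<sigma> where "\<sigma> = 1/2 \<or> \<sigma> = -1/2"
    "\<And>p. \<lbrakk>p \<in> circ_cone (1, \<sigma>); 0 < height p; height p < \<delta>\<rbrakk> \<Longrightarrow> h p \<in> circ_cone (e, 0)"
proof -
  define t where "t = R / (20 * L)"
  have t: "0 < t" using R L by (simp add: t_def)
  have tL: "20 * (L * t) = R" using L by (simp add: t_def)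
  have Lt: "t \<le> L * t" using L t(1) by (simp add: mult_le_cancel_right1)
  define q where "q = (t * e + t / 4, 0 :: real, t)"
  have q: "q \<in> circ_cone (e, 0)" using t by (simp add: q_def circ_cone_iff power_divide)
  have q0: "q \<noteq> 0" using t by (simp add: q_def zero_prod_def)
  have "norm (e, 0::real) \<le> 2" using e by (auto simp: norm_Pair)
  then have nq: "norm q \<le> 4 * t" using norm_circ_cone_le[OF q] by (simp add: q_def)
  then have "L * norm q \<le> L * (4 * t)" using L by (intro mult_left_mono) auto
  then have "L * norm q < \<delta>" using tL R(1) unfolding \<delta>_def by linarith
  moreover have "q \<in> X2 k" using q e by (auto simp: X2_eq three_cones_def)
  moreover have "norm q < R" using nq tL Lt t by linarith
  ultimately have gq: "q \<in> V" "g q \<in> X1 k" "0 < height (g q)" "height (g q) < \<delta>"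
    using g_small q0 by auto
  have "g q \<notin> peanut k"
    using h_peanut[of "g q"] gq hg[OF gq(1)] circ_cone_peanut_disjoint(1)[OF q e q0] by auto
  then have "g q \<in> circ_cone (1, 1/2) \<or> g q \<in> circ_cone (1, -1/2)"
    using gq(2) by (auto simp: X1_eq three_cones_def)
  then obtain \<sigma> where \<sigma>: "\<sigma> = 1/2 \<or> \<sigma> = -1/2" "g q \<in> circ_cone (1, \<sigma>)" by blast
  have "h p \<in> circ_cone (e, 0)" if "p \<in> circ_cone (1, \<sigma>)" "0 < height p" "height p < \<delta>" for p
  proof (rule part_image[OF connected_circ_cone_part _ \<sigma>(2) gq(3,4) _ _ that])
    show "circ_cone (1, \<sigma>) \<subseteq> X1 k"
      unfolding X1_eq three_cones_def using \<sigma>(1) by (elim disjE; hypsubst; blast)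
    show "h (g q) \<in> circ_cone (e, 0)" using q hg[OF gq(1)] by simp
  qed (use e in auto)
  then show thesis using that \<sigma>(1) by blast
qed

lemma contradiction: False
proof -
  obtain \<sigma> where \<sigma>: "\<sigma> = 1/2 \<or> \<sigma> = -1/2"
    "\<And>p. \<lbrakk>p \<in> circ_cone (1, \<sigma>); 0 < height p; height p < \<delta>\<rbrakk> \<Longrightarrow> h p \<in> circ_cone (1, 0)"
    using circ_cone_image[of 1] by blast
  obtain \<tau> where \<tau>: "\<tau> = 1/2 \<or> \<tau> = -1/2"
    "\<And>p. \<lbrakk>p \<in> circ_cone (1, \<tau>); 0 < height p; height p < \<delta>\<rbrakk> \<Longrightarrow> h p \<in> circ_cone (-1, 0)"
    using circ_cone_image[of "-1"] by blast
  \<comment> \<open>The first bound makes heights up to \<open>3 * (L * t)\<close> small enough for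
    \<open>neck_point_exists\<close>; the second keeps all points below in the domains.\<close>
  define t where "t = min (\<eta>^4 / (3 * L)) (R / (30 * L^2))"
  have t: "0 < t" "t \<le> \<eta>^4 / (3 * L)" "t \<le> R / (30 * L^2)" using \<eta> R L by (auto simp: t_def)
  have tb: "3 * (L * t) \<le> \<eta>^4" "30 * (L^2 * t) \<le> R" using t L by (auto simp: field_simps)
  have Lt: "t \<le> L * t" "L * t \<le> L^2 * t"
    using L L_le_sq t(1) by (auto simp: mult_le_cancel_right1 intro: mult_right_mono)
  have t\<delta>: "t < \<delta>" using Lt tb t(1) unfolding \<delta>_def by linarith
  \<comment> \<open>The segment at height \<open>t\<close> along \<open>x = t\<close>; for
    \<open>s\<close> from \<open>- t / 4\<close> to \<open>t / 4\<close> it joins the nearest points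
    of the two circles.\<close>
  define a where "a = (\<lambda>s. (t, s, t) :: real \<times> real \<times> real)"
  have a_cone: "a (\<rho> * t / 2) \<in> circ_cone (1, \<rho>)" if "\<rho> = 1/2 \<or> \<rho> = -1/2" for \<rho>
    using that by (elim disjE; hypsubst; insert t(1); simp add: a_def circ_cone_iff power2_eq_square)
  have ha: "height (a s) = t" for s by (simp add: a_def)
  have na: "norm (a s) \<le> 3 * t" if "\<bar>s\<bar> \<le> t / 4" for s
  proof -
    have "norm (a s) \<le> norm (offset (1, 0) (a s)) + (norm (1::real, 0::real) + 1) * \<bar>height (a s)\<bar>"
      by (rule norm_le_offset)
    also have "offset (1, 0) (a s) = (0, s)" by (simp add: a_def offset_def)
    finally show ?thesis using that t by (simp add: norm_Pair ha)
  qed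
  have aU: "a s \<in> U" if "\<bar>s\<bar> \<le> t / 4" for s
    using na[OF that] Lt tb t R by (intro in_U) linarith
  have a0: "h (a s) \<noteq> 0" if "\<bar>s\<bar> \<le> t / 4" for s
    using h_nonzero[OF aU[OF that]] t by (simp add: a_def zero_prod_def)
  have \<sigma>t: "\<bar>\<sigma> * t / 2\<bar> \<le> t / 4" "\<bar>\<tau> * t / 2\<bar> \<le> t / 4" using \<sigma>(1) \<tau>(1) t by auto
  have h\<sigma>: "h (a (\<sigma> * t / 2)) \<in> circ_cone (1, 0)" using \<sigma> a_cone ha t t\<delta> by auto
  have h\<tau>: "h (a (\<tau> * t / 2)) \<in> circ_cone (-1, 0)" using \<tau> a_cone ha t t\<delta> by auto
  have "\<sigma> \<noteq> \<tau>"
    using h\<sigma> h\<tau> circ_cone_peanut_disjoint(2)[OF h\<sigma>] a0[OF \<sigma>t(1)] by auto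
  then have all_cones: "circ_cone (1, 1/2) \<union> circ_cone (1, -1/2) = circ_cone (1, \<sigma>) \<union> circ_cone (1, \<tau>)"
    using \<sigma>(1) \<tau>(1) by (elim disjE; hypsubst; blast)
  \<comment> \<open>The segment stays within \<open>t / 4\<close> of the axis of the lobe, while the
    peanut is at distance at least \<open>t\<close>. So it meets \<open>X1\<close> only in the
    cones, and these are sent to cones.\<close>
  have avoid: "h (a s) \<notin> peanut k" if s: "\<bar>s\<bar> \<le> t / 4" for s
  proof
    assume p: "h (a s) \<in> peanut k"
    then have "a s \<in> X1 k" using h_X_iff[OF aU[OF s]] by (auto simp: X2_eq three_cones_def)
    moreover have "a s \<notin> peanut k"
    proof
      assume "a s \<in> peanut k"
      then have "t^2 - 2 * t * t + s^2 \<ge> 0" unfolding a_def by (rule peanut_factors_nonneg)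
      then have "\<bar>t\<bar> \<le> \<bar>s\<bar>" by (simp add: abs_le_square_iff power2_eq_square)
      then show False using s t by simp
    qed
    ultimately have "a s \<in> circ_cone (1, \<sigma>) \<union> circ_cone (1, \<tau>)"
      unfolding all_cones[symmetric] by (auto simp: X1_eq three_cones_def)
    then have "h (a s) \<in> circ_cone (1, 0) \<or> h (a s) \<in> circ_cone (-1, 0)"
      using \<sigma>(2)[of "a s"] \<tau>(2)[of "a s"] t t\<delta> ha by auto
    then show False using p a0[OF s] circ_cone_peanut_disjoint(1)[of "h (a s)"] by auto
  qed
  let ?I = "{- (t / 4)..t / 4}"
  have I: "s \<in> ?I \<longleftrightarrow> \<bar>s\<bar> \<le> t / 4" for s by auto
  have "continuous_on ?I a" unfolding a_def by (intro continuous_intros)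
  moreover have "continuous_on (a ` ?I) h"
    using homeo aU by (auto simp: homeomorphism_def intro!: continuous_on_subset[of U h])
  ultimately have cont: "continuous_on ?I (h \<circ> a)" by (rule continuous_on_compose)
  then have conn: "connected ((h \<circ> a) ` ?I)" by (intro connected_continuous_image) auto
  have pos: "0 < height (h (a s))" if "\<bar>s\<bar> \<le> t / 4" "h (a s) \<in> circ_cone (e, 0)" "e = 1 \<or> e = -1" for s e
    using three_cones_height_pos[OF k admissible_X2[of k] _ a0[OF that(1)]] that(2,3)
    by (auto simp: three_cones_def)
  have inside: "0 < height (h (a s))" "peanut_fun k (h (a s)) < 0" if "\<bar>s\<bar> \<le> t / 4" for s
  proof -
    have "h (a (\<sigma> * t / 2)) \<in> (h \<circ> a) ` ?I" "h (a s) \<in> (h \<circ> a) ` ?I"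
      using \<sigma>t that unfolding I[symmetric] by auto
    moreover have "(h \<circ> a) ` ?I \<inter> peanut k = {}" using avoid by auto
    moreover have "0 < height (h (a (\<sigma> * t / 2)))" using pos[OF \<sigma>t(1) h\<sigma>] by simp
    moreover from this have "peanut_fun k (h (a (\<sigma> * t / 2))) < 0"
      using circ_cone_inside(2)[OF h\<sigma>] by simp
    ultimately show "0 < height (h (a s))" "peanut_fun k (h (a s)) < 0"
      using connected_inside_peanut[OF k conn] by blast+
  qed
  have "connected (fst ` ((h \<circ> a) ` ?I))"
    by (rule connected_continuous_image[OF _ conn]) (intro continuous_intros)
  moreover have "fst (h (a (\<sigma> * t / 2))) \<in> fst ` ((h \<circ> a) ` ?I)" "fst (h (a (\<tau> * t / 2))) \<in> fst ` ((h \<circ> a) ` ?I)"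
    using \<sigma>t unfolding I[symmetric] by auto
  moreover have "0 < fst (h (a (\<sigma> * t / 2)))" "fst (h (a (\<tau> * t / 2))) < 0"
    using circ_cone_inside(1)[OF h\<sigma>] circ_cone_inside(1)[OF h\<tau>] pos[OF \<sigma>t(1) h\<sigma>] pos[OF \<sigma>t(2) h\<tau>] by auto
  ultimately have "0 \<in> fst ` ((h \<circ> a) ` ?I)"
    by (meson connectedD_interval less_imp_le)
  then obtain s where s: "\<bar>s\<bar> \<le> t / 4" "fst (h (a s)) = 0" unfolding I[symmetric] by auto
  obtain y w where yw: "h (a s) = (0, y, w)" using s(2) by (metis prod.collapse)
  have w: "0 < w" and "y^4 < w^k"
    using inside[OF s(1)] by (auto simp: yw peanut_fun_def power2_eq_square power4_eq_xxxx mult.assoc)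
  have "w \<le> norm (h (a s))" using height_le[of "h (a s)"] by (simp add: yw)
  also have "\<dots> \<le> L * (3 * t)"
    using norm_h(1)[OF aU[OF s(1)]] mult_left_mono[OF na[OF s(1)], of L] L by linarith
  finally have wt: "w \<le> 3 * (L * t)" by simp
  have "w \<le> 1" "w \<le> \<eta>^4" using wt tb Lt R t by linarith+
  then obtain r where r: "0 < r" "r \<le> \<eta> * w" "r^4 = w^k"
    using neck_point_exists[OF k w _ \<eta>] by blast
  have "\<bar>y\<bar>^4 \<le> r^4" using \<open>y^4 < w^k\<close> r(3) by simp
  then have y: "\<bar>y\<bar> \<le> r"
    using r(1) by (intro power_le_imp_le_base[of "\<bar>y\<bar>" 3]) (auto simp: eval_nat_numeral)
  \<comment> \<open>A peanut point in the neck at the height of \<open>h (a s)\<close>. Since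
    \<bar>y\<bar> is at most \<open>r\<close>, the two are at distance at most \<open>2 * r\<close>,
    small compared with \<open>t\<close>.\<close>
  define q where "q = (0 :: real, r, w)"
  have q: "q \<in> peanut k" using r w by (auto simp: q_def intro!: neck_point_in_peanut)
  have q0: "q \<noteq> 0" using w by (simp add: q_def zero_prod_def)
  have "1 \<le> 1000 * L^2" using L L_le_sq by linarith
  then have "\<eta> \<le> 1" using L by (simp add: \<eta>_def divide_simps)
  then have "\<eta> * w \<le> 1 * w" using w by (intro mult_right_mono) auto
  then have "r \<le> w" using r(2) by simp
  moreover have "norm q \<le> r + w"
    using r w by (auto simp: q_def norm_Pair intro: sqrt_sum_squares_le_sum)
  ultimately have nq: "norm q \<le> 6 * (L * t)" using wt by linarith
  then have "L * norm q \<le> L * (6 * (L * t))" using L by (intro mult_left_mono) auto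
  also have "\<dots> = 6 * (L^2 * t)" by (simp add: power2_eq_square)
  also have "\<dots> < \<delta>" using tb R by (simp add: \<delta>_def)
  finally have "L * norm q < \<delta>" .
  moreover have "norm q < R" using nq tb Lt t by linarith
  moreover have "q \<in> X2 k" using q by (simp add: X2_eq three_cones_def)
  ultimately have gq: "q \<in> V" "g q \<in> X1 k" "0 < height (g q)" "height (g q) < \<delta>"
    using g_small q0 by auto
  have gP: "g q \<in> peanut k"
  proof (rule ccontr)
    assume "g q \<notin> peanut k"
    then have "g q \<in> circ_cone (1, \<sigma>) \<union> circ_cone (1, \<tau>)"
      unfolding all_cones[symmetric] using gq(2) by (auto simp: X1_eq three_cones_def)
    then have "q \<in> circ_cone (1, 0) \<or> q \<in> circ_cone (-1, 0)"
      using \<sigma>(2)[of "g q"] \<tau>(2)[of "g q"] gq hg[OF gq(1)] by auto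
    then show False using q q0 circ_cone_peanut_disjoint(1)[of q] by auto
  qed
  have "dist (a s) (g q) \<le> L * dist (h (a s)) q"
    using lip(1)[OF aU[OF s(1)] g_in[OF gq(1)]] by (simp add: hg[OF gq(1)])
  also have "dist (h (a s)) q = \<bar>y - r\<bar>" by (simp add: yw q_def dist_Pair_Pair dist_real_def)
  also have "L * \<bar>y - r\<bar> \<le> L * (2 * (\<eta> * (3 * (L * t))))"
  proof (intro mult_left_mono)
    have "\<eta> * w \<le> \<eta> * (3 * (L * t))" using \<eta> wt by (intro mult_left_mono) auto
    then show "\<bar>y - r\<bar> \<le> 2 * (\<eta> * (3 * (L * t)))" using y r by linarith
  qed (use L in auto)
  also have "\<dots> = 6 / 1000 * (1000 * L^2 * \<eta>) * t" by (simp add: power2_eq_square)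
  finally have d: "dist (a s) (g q) \<le> 6 / 1000 * t" by (simp add: \<eta>_L)
  \<comment> \<open>Final clash: \<open>g q\<close> lies on the peanut, so its offset is at least
    its height, about \<open>t\<close>; yet it is within \<open>6 / 1000 * t\<close> of
    \<open>a s\<close>, whose offset is at most \<open>t / 4\<close>.\<close>
  have "height (g q) \<le> norm (offset (1, 0) (g q))" using norm_offset_peanut_ge[OF gP] by simp
  moreover have "norm (offset (1, 0) (g q) - offset (1, 0) (a s)) \<le> 2 * dist (a s) (g q)"
    using norm_offset_dist_le[of "(1, 0)" "g q" "a s"] by (simp add: norm_Pair dist_commute)
  moreover have "norm (offset (1, 0) (a s)) = \<bar>s\<bar>" by (simp add: a_def offset_def norm_Pair)
  moreover have "\<bar>t - height (g q)\<bar> \<le> dist (a s) (g q)" using height_dist_le[of "a s" "g q"] by (simp add: ha)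
  ultimately show False
    using norm_triangle_ineq2[of "offset (1, 0) (g q)" "offset (1, 0) (a s)"] s(1) d t by linarith
qed

end

proposition not_ambient_lipschitz_equiv_X1_X2:
  assumes k: "k > 4"
  shows "\<not> ambient_lipschitz_equiv (X1 k) (X2 k)"
proof
  assume "ambient_lipschitz_equiv (X1 k) (X2 k)"
  then obtain U V h g L where *: "open U" "open V" "0 \<in> U" "0 \<in> V" "homeomorphism U V h g" "h 0 = 0"
      "h ` (X1 k \<inter> U) = X2 k \<inter> V" "L > 0"
    and lip: "\<forall>a\<in>U. \<forall>b\<in>U. dist a b \<le> L * dist (h a) (h b) \<and> dist (h a) (h b) \<le> L * dist a b"
    unfolding ambient_lipschitz_equiv_def by blast
  obtain R1 R2 where R12: "R1 > 0" "ball 0 R1 \<subseteq> U" "R2 > 0" "ball 0 R2 \<subseteq> V"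
    using *(1-4) by (meson open_contains_ball)
  define R where "R = min 1 (min R1 R2)"
  have R: "0 < R" "R \<le> 1" "ball 0 R \<subseteq> U" "ball 0 R \<subseteq> V"
    using R12 by (auto simp: R_def subset_iff)
  \<comment> \<open>Enlarging the constant keeps both bounds and provides \<open>1 \<le> L\<close>
    for the locale.\<close>
  have mono: "L * dist p q \<le> max L 1 * dist p q" for p q :: "real \<times> real \<times> real"
    by (intro mult_right_mono) auto
  have "dist p q \<le> max L 1 * dist (h p) (h q)" "dist (h p) (h q) \<le> max L 1 * dist p q"
    if "p \<in> U" "q \<in> U" for p q
    using lip that mono[of p q] mono[of "h p" "h q"] by (meson order_trans)+
  then have "ambient_bilipschitz k U V h g (max L 1) R"
    using k *(5-7) R by unfold_locales auto
  then show False by (rule ambient_bilipschitz.contradiction)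
qed

theorem theorem2p1:
  fixes k :: nat
  assumes "k > 4"
  shows "outer_lipschitz_equiv (X1 k) (X2 k) \<and> ambient_topo_equiv (X1 k) (X2 k) \<and>
         \<not> ambient_lipschitz_equiv (X1 k) (X2 k)"
  using ambient_topo_equiv_X1_X2[OF assms] not_ambient_lipschitz_equiv_X1_X2[OF assms]
    outer_lipschitz_equiv_three_cones[OF assms admissible_X1 admissible_X2, folded X1_eq X2_eq]
  by blast

end
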